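(* For each positive integer $g$, let $N(g)$ be the number of numerical semigroups of genus $g$, and let $NB(g)$ be the number of numerical semigroups of genus $g$ which fail the Buchweitz criterion for some $n$. Then \[\lim_{g \to \infty} \frac{NB(g)}{N(g)} = 0.\]
   Context: A numerical semigroup $S$ is an additive submonoid of $\mathbb{N}=\{0,1,2,\ldots\}$ (containing $0$) such that $\mathbb{N}\setminus S$ is finite. The complement $H(S)=\mathbb{N}\setminus S$ is the gap set, and its size is the genus $g(S)$. For a set $H$ of integers and $n\ge 1$, $nH=\{h_1+\cdots+h_n : h_1,\ldots,h_n\in H\}$ is the $n$-fold sumset. A numerical semigroup $S$ of genus $g$ fails the Buchweitz criterion for the integer $n>1$ if $|nH(S)| > (2n-1)(g-1)$; it fails the criterion for some $n$ if there exists an integer $n>1$ with this property. *)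

theory Defs
  imports Complex_Main
begin

definition numerical_semigroup :: "nat set \<Rightarrow> bool" where
  "numerical_semigroup S \<longleftrightarrow>
     0 \<in> S \<and> (\<forall>x\<in>S. \<forall>y\<in>S. x + y \<in> S) \<and> finite (UNIV - S)"

definition gaps :: "nat set \<Rightarrow> nat set" where
  "gaps S = UNIV - S"

definition genus :: "nat set \<Rightarrow> nat" where
  "genus S = card (gaps S)"

(* The summands h 0, ..., h (n - 1) need not be distinct. *)
definition nfold_sumset :: "nat \<Rightarrow> 'a::comm_monoid_add set \<Rightarrow> 'a set" where
  "nfold_sumset n H = {(\<Sum>i<n. h i) | h. \<forall>i<n. h i \<in> H}"

(* The bound is computed in int, so that neither subtraction truncates. *)
definition fails_Buchweitz_for :: "nat set \<Rightarrow> nat \<Rightarrow> bool" where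
  "fails_Buchweitz_for S n \<longleftrightarrow>
     n > 1 \<and> int (card (nfold_sumset n (gaps S))) > (2 * int n - 1) * (int (genus S) - 1)"

definition fails_Buchweitz :: "nat set \<Rightarrow> bool" where
  "fails_Buchweitz S \<longleftrightarrow> (\<exists>n. fails_Buchweitz_for S n)"

(* Both sets counted below are finite: if x is a gap, then for each i \<le> x at least one of
   i and x - i is a gap, so every gap of a semigroup of genus g is at most 2 * g - 1. *)
definition num_semigroups :: "nat \<Rightarrow> nat" where
  "num_semigroups g = card {S. numerical_semigroup S \<and> genus S = g}"

definition num_Buchweitz_failing :: "nat \<Rightarrow> nat" where
  "num_Buchweitz_failing g =
     card {S. numerical_semigroup S \<and> genus S = g \<and> fails_Buchweitz S}"

end

(* If F is the largest gap, then nH lies in [n, nF], so failing the criterion forces F to be at least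
   about 3g/2. There are at least fib (g + 1) semigroups of genus g, so it suffices that the number of
   those with such an F is exponentially smaller than psi^-g, where psi = (sqrt 5 - 1) / 2. Let m be
   the multiplicity.

   If F - 2m is at most g/100, then weighting every gap by 1/2 and multiplying over the pairs
   (i, F - i), which never lie both in the semigroup, gives a bound just below psi^-g.

   If F - 2m is larger, then weight every gap by psi and let y be the last place near which gaps are
   not rare, so that the gaps above y can be encoded at subexponential cost. If y is close to 2m, then
   nearly all numbers i in (y, F] are elements, each of which forces the gap F - i, and the
   same pairing gives an exponentially small total weight. Otherwise the elements between m and y - m
   form an independent set in a dense graph, a gap d near y giving the edges {v, d - v}. So they
   lie in one of subexponentially many containers, each with only about 2/3 of the positions, and
   closure under adding m makes the weight of each container exponentially small. *)
theory Submission
  imports Defs "HOL-Library.FuncSet" "HOL-Number_Theory.Fib" "HOL-Real_Asymp.Real_Asymp"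
begin

section \<open>Counting small subsets, and the weight \<open>psi\<close>\<close>

lemma card_bounded_subsets_le:
  assumes "finite A"
  shows "card {T. T \<subseteq> A \<and> card T \<le> k} \<le> (card A + 1) ^ k"
proof (induction k)
  case 0
  have "{T. T \<subseteq> A \<and> card T \<le> 0} = {{}}"
    using finite_subset[OF _ assms] by auto
  then show ?case by simp
next
  case (Suc k)
  let ?S = "\<lambda>k. {T. T \<subseteq> A \<and> card T \<le> k}"
  let ?f = "\<lambda>(z, T). case z of None \<Rightarrow> T | Some a \<Rightarrow> insert a T"
  have fin: "finite (?S k)" using assms by simp
  \<comment> \<open>\<open>None\<close> is used here only for the empty set; a nonempty set arises
    by inserting one of its elements into a smaller set.\<close>
  have "?S (Suc k) \<subseteq> ?f ` (insert None (Some ` A) \<times> ?S k)"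
  proof
    fix T assume T: "T \<in> ?S (Suc k)"
    show "T \<in> ?f ` (insert None (Some ` A) \<times> ?S k)"
    proof (cases "T = {}")
      case True
      then show ?thesis by (intro image_eqI[of _ _ "(None, {})"]) auto
    next
      case False
      then obtain a where a: "a \<in> T" by auto
      have "finite T" using T assms finite_subset by auto
      then have "T - {a} \<in> ?S k" using T a by auto
      then show ?thesis using a T by (intro image_eqI[of _ _ "(Some a, T - {a})"]) auto
    qed
  qed
  then have "card (?S (Suc k)) \<le> card (insert None (Some ` A) \<times> ?S k)"
    by (rule surj_card_le[rotated]) (use assms fin in auto)
  also have "\<dots> = (card A + 1) * card (?S k)"
    using assms by (simp add: card_cartesian_product card_image)
  also have "\<dots> \<le> (card A + 1) * (card A + 1) ^ k"
    using Suc.IH by (intro mult_left_mono) auto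
  finally show ?case by simp
qed

text \<open>The reciprocal of the golden ratio: by \<open>psi + psi ^ 2 = 1\<close>, a pair of positions of which one
  is a gap and the other is free has total weight 1 when every gap is weighted by \<open>psi\<close>.\<close>

definition psi :: real where "psi = (sqrt 5 - 1) / 2"

lemma psi_pos: "0 < psi" unfolding psi_def by simp

lemma psi_eq: "psi * (1 + psi) = 1"
  unfolding psi_def by (simp add: field_simps)

lemma psi_less: "psi < 0.61804"
proof -
  have "sqrt 5 < 2.23608" by (rule real_less_lsqrt) (auto simp: power2_eq_square)
  then show ?thesis unfolding psi_def by simp
qed

text \<open>The identity \<open>psi = psi ^ 2 + psi ^ 3\<close> matches the Fibonacci recursion, so
  the two initial values suffice. A count is therefore negligible once its product with
  \<open>psi ^ g\<close> tends to 0.\<close>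

lemma fib_psi_ge: "psi \<le> real (fib (Suc g)) * psi ^ g"
proof (induction g rule: fib.induct)
  case 1
  show ?case using psi_less by simp
next
  case 2
  show ?case by simp
next
  case (3 g)
  have "psi = psi * psi + psi ^ 2 * psi"
    using arg_cong[OF psi_eq, of "\<lambda>t. psi * t"] by (simp add: algebra_simps power2_eq_square)
  also have "\<dots> \<le> (real (fib (Suc (Suc g))) * psi ^ Suc g) * psi
                  + psi ^ 2 * (real (fib (Suc g)) * psi ^ g)"
    using 3 psi_pos by (intro add_mono mult_right_mono mult_left_mono) auto
  also have "\<dots> = real (fib (Suc (Suc (Suc g)))) * psi ^ Suc (Suc g)"
    by (simp add: algebra_simps power2_eq_square)
  finally show ?case .
qed

subsection \<open>Lower bound for the number of semigroups\<close>

text \<open>Since \<open>i\<close> and \<open>F - i\<close> are never both in \<open>S\<close>, the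
  gaps up to \<open>F\<close> and their reflections cover all \<open>F + 1\<close> numbers of
  \<open>{..F}\<close>.\<close>

lemma gap_less_twice_genus:
  assumes "numerical_semigroup S" "F \<in> gaps S"
  shows "F < 2 * genus S"
proof -
  have fin: "finite (gaps S)" using assms by (simp add: numerical_semigroup_def gaps_def)
  have "{..F} \<subseteq> (gaps S \<inter> {..F}) \<union> (\<lambda>i. F - i) ` (gaps S \<inter> {..F})"
  proof
    fix i assume i: "i \<in> {..F}"
    then have "i \<in> gaps S \<or> F - i \<in> gaps S"
      using assms unfolding numerical_semigroup_def gaps_def
      by (metis DiffD2 DiffI UNIV_I atMost_iff le_add_diff_inverse)
    then show "i \<in> (gaps S \<inter> {..F}) \<union> (\<lambda>i. F - i) ` (gaps S \<inter> {..F})"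
    proof
      assume "F - i \<in> gaps S"
      then have "i \<in> (\<lambda>i. F - i) ` (gaps S \<inter> {..F})"
        using i by (intro image_eqI[of _ _ "F - i"]) auto
      then show ?thesis by simp
    qed (use i in auto)
  qed
  then have "card {..F} \<le> card (gaps S \<inter> {..F}) + card ((\<lambda>i. F - i) ` (gaps S \<inter> {..F}))"
    using card_mono card_Un_le fin by (meson finite_Int finite_UnI finite_imageI le_trans)
  also have "\<dots> \<le> card (gaps S \<inter> {..F}) + card (gaps S \<inter> {..F})"
    using fin by (intro add_left_mono card_image_le) auto
  also have "\<dots> \<le> 2 * card (gaps S)" using card_mono[OF fin, of "gaps S \<inter> {..F}"] by simp
  finally show ?thesis unfolding genus_def by simp
qed

lemma finite_semigroups_genus: "finite {S. numerical_semigroup S \<and> genus S = g}"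
proof (rule finite_subset)
  show "{S. numerical_semigroup S \<and> genus S = g} \<subseteq> (\<lambda>H. UNIV - H) ` Pow {..<2 * g}"
  proof
    fix S assume S: "S \<in> {S. numerical_semigroup S \<and> genus S = g}"
    then have "gaps S \<in> Pow {..<2 * g}" using gap_less_twice_genus by auto
    moreover have "S = UNIV - gaps S" by (auto simp: gaps_def)
    ultimately show "S \<in> (\<lambda>H. UNIV - H) ` Pow {..<2 * g}" by blast
  qed
qed auto

text \<open>Semigroups of multiplicity \<open>m = g + 1 - k\<close> with all gaps below \<open>2 * m\<close> suffice: any \<open>k\<close> elements
  of \<open>{m<..<2 * m}\<close> may be the gaps above \<open>m\<close>.\<close>

lemma fib_le_num_semigroups: "fib (Suc g) \<le> num_semigroups g"
proof -
  define Y where "Y k = {Y. Y \<subseteq> {g + 1 - k<..<2 * (g + 1 - k)} \<and> card Y = k}" for k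
  define h where "h = (\<lambda>(k, Y). UNIV - ({1..<g + 1 - k} \<union> Y))"
  have finY: "finite (Y k)" for k
    unfolding Y_def by (rule finite_subset[of _ "Pow {g + 1 - k<..<2 * (g + 1 - k)}"]) auto
  have cardY: "card (Y k) = (g - k) choose k" for k
    unfolding Y_def by (subst n_subsets) (auto simp: le_diff_conv)
  have least: "g + 1 - k \<in> h (k, Z)" "\<And>i. 0 < i \<Longrightarrow> i < g + 1 - k \<Longrightarrow> i \<notin> h (k, Z)"
    if "Z \<in> Y k" "k \<le> g" for k Z
    using that by (auto simp: h_def Y_def)
  have inj: "inj_on h (SIGMA k:{0..g}. Y k)"
  proof (rule inj_onI, clarify)
    fix k Z k' Z' assume k: "k \<in> {0..g}" "k' \<in> {0..g}" and Z: "Z \<in> Y k" "Z' \<in> Y k'"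
      and eq: "h (k, Z) = h (k', Z')"
    \<comment> \<open>The least positive element is \<open>g + 1 - k\<close>, so the semigroup
      determines \<open>k\<close>, and then \<open>Z\<close>.\<close>
    have "\<not> g + 1 - k < g + 1 - k'" "\<not> g + 1 - k' < g + 1 - k"
      using least[of Z k] least[of Z' k'] k Z eq by auto
    then have kk: "k = k'" using k by auto
    moreover have "Z = {g + 1 - k<..<2 * (g + 1 - k)} - h (k, Z)"
      using Z by (auto simp: h_def Y_def)
    moreover have "Z' = {g + 1 - k<..<2 * (g + 1 - k)} - h (k', Z')"
      using Z kk by (auto simp: h_def Y_def)
    ultimately show "k = k' \<and> Z = Z'" using eq by auto
  qed
  have sub: "h ` (SIGMA k:{0..g}. Y k) \<subseteq> {S. numerical_semigroup S \<and> genus S = g}"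
  proof clarify
    fix k Z assume k: "k \<in> {0..g}" and Z: "Z \<in> Y k"
    define m where "m = g + 1 - k"
    have m: "m \<ge> 1" "m + k = g + 1" using k by (auto simp: m_def)
    have Z': "Z \<subseteq> {m<..<2 * m}" "card Z = k" using Z by (auto simp: Y_def m_def)
    have fZ: "finite Z" using Z' finite_subset by blast
    have h: "h (k, Z) = UNIV - ({1..<m} \<union> Z)" by (simp add: h_def m_def)
    have g: "gaps (h (k, Z)) = {1..<m} \<union> Z" by (auto simp: h gaps_def)
    have "{1..<m} \<inter> Z = {}" using Z' by auto
    then have "genus (h (k, Z)) = g"
      unfolding genus_def g using m Z' fZ by (simp add: card_Un_disjoint)
    moreover have "numerical_semigroup (h (k, Z))"
      unfolding numerical_semigroup_def
    proof (intro conjI ballI)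
      show "0 \<in> h (k, Z)" using Z' by (auto simp: h)
      show "finite (UNIV - h (k, Z))" using g fZ by (simp add: gaps_def)
      fix x y assume xy: "x \<in> h (k, Z)" "y \<in> h (k, Z)"
      consider "x = 0" | "y = 0" | "x \<ge> m" "y \<ge> m"
        using xy by (auto simp: h)
      then show "x + y \<in> h (k, Z)"
      proof cases
        case 3
        then have "x + y \<ge> 2 * m" by simp
        then show ?thesis using Z' by (auto simp: h)
      qed (use xy in auto)
    qed
    ultimately show "numerical_semigroup (h (k, Z)) \<and> genus (h (k, Z)) = g" by simp
  qed
  \<comment> \<open>The coefficients \<open>(g - k) choose k\<close> form a diagonal of Pascal's
    triangle, whose sum is a Fibonacci number.\<close>
  have "fib (Suc g) = (\<Sum>k = 0..g. card (Y k))"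
    by (simp add: cardY ne_diagonal_fib)
  also have "\<dots> = card (SIGMA k:{0..g}. Y k)" using finY by (subst card_SigmaI) auto
  also have "\<dots> = card (h ` (SIGMA k:{0..g}. Y k))" using inj by (simp add: card_image)
  also have "\<dots> \<le> card {S. numerical_semigroup S \<and> genus S = g}"
    using sub finite_semigroups_genus by (rule card_mono[rotated])
  finally show ?thesis unfolding num_semigroups_def .
qed

section \<open>Failing the criterion forces a large Frobenius number\<close>

lemma card_nfold_sumset_le:
  fixes H :: "nat set"
  assumes "\<And>h. h \<in> H \<Longrightarrow> 0 < h \<and> h \<le> F"
  shows "card (nfold_sumset n H) \<le> n * F + 1 - n"
proof -
  have "nfold_sumset n H \<subseteq> {n..n * F}"
  proof
    fix s assume "s \<in> nfold_sumset n H"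
    then obtain h where h: "s = (\<Sum>i<n. h i)" "\<And>i. i < n \<Longrightarrow> h i \<in> H"
      by (auto simp: nfold_sumset_def)
    have "(\<Sum>i<n. 1) \<le> (\<Sum>i<n. h i)" by (rule sum_mono) (use assms h in force)
    moreover have "(\<Sum>i<n. h i) \<le> (\<Sum>i<n. F)" by (rule sum_mono) (use assms h in force)
    ultimately show "s \<in> {n..n * F}" using h by simp
  qed
  then have "card (nfold_sumset n H) \<le> card {n..n * F}" by (rule card_mono[rotated]) auto
  then show ?thesis by simp
qed

text \<open>The sumset has at most \<open>n * (F - 1) + 1\<close> elements. If
  \<open>2 * F + 2\<close> is at most \<open>3 * genus S\<close>, this falls short of the Buchweitz
  bound by at least \<open>(n - 2) * genus S / 2\<close>, so \<open>n = 2\<close> is the critical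
  case and yields the ratio 3/2.\<close>

lemma fails_Buchweitz_large_gap:
  assumes S: "numerical_semigroup S" and "fails_Buchweitz S" and F: "\<And>h. h \<in> gaps S \<Longrightarrow> h \<le> F"
    and F1: "F \<ge> 1"
  shows "3 * genus S \<le> 2 * F + 1"
proof (rule ccontr)
  assume "\<not> 3 * genus S \<le> 2 * F + 1"
  then have small: "2 * int F + 2 \<le> 3 * int (genus S)" by linarith
  obtain n where n: "n > 1"
    and big: "int (card (nfold_sumset n (gaps S))) > (2 * int n - 1) * (int (genus S) - 1)"
    using assms by (auto simp: fails_Buchweitz_def fails_Buchweitz_for_def)
  have "card (nfold_sumset n (gaps S)) \<le> n * F + 1 - n"
    using F S by (intro card_nfold_sumset_le) (auto simp: gaps_def numerical_semigroup_def intro!: gr0I)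
  moreover have "n \<le> n * F" using F1 by simp
  ultimately have "card (nfold_sumset n (gaps S)) + n \<le> n * F + 1" by linarith
  then have "int (card (nfold_sumset n (gaps S))) + int n \<le> int (n * F) + 1" by linarith
  then have "int (card (nfold_sumset n (gaps S))) \<le> int n * int F + 1 - int n"
    by simp
  with big have "(2 * int n - 1) * (int (genus S) - 1) < int n * int F + 1 - int n" by simp
  moreover have "int n * (2 * int F + 2) \<le> int n * (3 * int (genus S))"
    using small by (rule mult_left_mono) simp
  moreover have "2 * int (genus S) \<le> int n * int (genus S)"
    using n by (intro mult_right_mono) auto
  ultimately show False by (simp add: algebra_simps)
qed


subsection \<open>Containers for independent sets\<close>

text \<open>Depends on the fingerprint \<open>T\<close> but not on the independent set, so there are
  no more containers than fingerprints. \<open>N\<close> is the neighbourhood map of the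
  graph.\<close>

definition container :: "('a \<Rightarrow> 'a set) \<Rightarrow> 'a set \<Rightarrow> nat \<Rightarrow> 'a set \<Rightarrow> 'a set" where
  "container N V e T = {v \<in> V. card (N v - \<Union> (N ` T)) < e} - \<Union> (N ` T)"

text \<open>Let \<open>W\<close> be the neighbours of \<open>T\<close> and \<open>D\<close> the
  vertices with fewer than \<open>e\<close> neighbours outside \<open>W\<close>. Each vertex of
  \<open>D\<close> sends at least \<open>e\<close> of its \<open>2 * e\<close> edges into
  \<open>W\<close>, and each point of \<open>W\<close> receives at most \<open>2 * e\<close>, so
  \<open>D\<close> is at most twice as large as \<open>W\<close>. As \<open>D - W\<close> also
  avoids \<open>W\<close>, it has at most two thirds of \<open>U\<close>.\<close>

lemma card_container_le:
  assumes fin: "finite U" and VU: "V \<subseteq> U" and TV: "T \<subseteq> V" and e: "e > 0"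
    and N: "\<And>v. v \<in> V \<Longrightarrow> N v \<subseteq> U \<and> card (N v) = 2 * e"
    and deg: "\<And>u. u \<in> U \<Longrightarrow> card {v \<in> V. u \<in> N v} \<le> 2 * e"
  shows "3 * card (container N V e T) \<le> 2 * card U"
proof -
  define W where "W = \<Union> (N ` T)"
  define D where "D = {v \<in> V. card (N v - W) < e}"
  have C: "container N V e T = D - W" by (simp add: container_def D_def W_def)
  have WU: "W \<subseteq> U" using N TV by (auto simp: W_def)
  have DU: "D \<subseteq> U" using VU by (auto simp: D_def)
  have fW: "finite W" and fD: "finite D" using WU DU fin finite_subset by auto
  have ge: "e \<le> card {u \<in> W. u \<in> N v}" if v: "v \<in> D" for v
  proof -
    have "finite (N v)" using N v fin finite_subset unfolding D_def by blast
    then have "card (N v) = card (N v \<inter> W) + card (N v - W)" by (rule card_Int_Diff)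
    moreover have "N v \<inter> W = {u \<in> W. u \<in> N v}" by auto
    ultimately show ?thesis using v N[of v] by (simp add: D_def)
  qed
  have le: "card {v \<in> D. u \<in> N v} \<le> 2 * e" if u: "u \<in> W" for u
  proof -
    have "finite {v \<in> V. u \<in> N v}" using fin VU finite_subset by fastforce
    then have "card {v \<in> D. u \<in> N v} \<le> card {v \<in> V. u \<in> N v}"
      by (rule card_mono) (auto simp: D_def)
    then show ?thesis using deg[of u] u WU by auto
  qed
  have "e * card D \<le> (\<Sum>v\<in>D. card {u \<in> W. u \<in> N v})"
    using sum_mono[of D "\<lambda>_. e", OF ge] by (simp add: mult.commute)
  also have "\<dots> = (\<Sum>u\<in>W. card {v \<in> D. u \<in> N v})"
    by (rule sum_multicount_gen) (use fW fD in auto)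
  also have "\<dots> \<le> 2 * e * card W"
    using sum_mono[of W _ "\<lambda>_. 2 * e", OF le] by (simp add: mult.commute)
  finally have "card D \<le> 2 * card W" using e by simp
  moreover have "card (D - W) \<le> card D" using fD by (intro card_mono) auto
  moreover have "card (D - W) \<le> card (U - W)" using DU fin by (intro card_mono) auto
  moreover have "card (U - W) + card W = card U"
    using WU fin fW by (metis card_Diff_subset card_mono le_add_diff_inverse2)
  ultimately show ?thesis unfolding C by linarith
qed

text \<open>A largest \<open>T \<subseteq> I\<close> of which every element contributes \<open>e\<close> new neighbours on average is the
  fingerprint: any element of \<open>I\<close> with \<open>e\<close> neighbours outside \<open>\<Union> (N ` T)\<close> could be added to it.\<close>

lemma independent_set_container:
  assumes fin: "finite U" and IV: "I \<subseteq> V" and VU: "V \<subseteq> U" and e: "e > 0"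
    and N: "\<And>v. v \<in> V \<Longrightarrow> N v \<subseteq> U"
    and indep: "\<And>v. v \<in> I \<Longrightarrow> N v \<inter> I = {}"
  obtains T where "T \<subseteq> I" "e * card T \<le> card U" "I \<subseteq> container N V e T"
proof -
  define P where "P T \<longleftrightarrow> T \<subseteq> I \<and> e * card T \<le> card (\<Union> (N ` T))" for T
  have fI: "finite I" using IV VU fin by (meson finite_subset)
  have "P {}" by (simp add: P_def)
  moreover have "\<forall>T. P T \<longrightarrow> card T < Suc (card I)"
  proof (intro allI impI)
    fix T assume "P T"
    then have "T \<subseteq> I" unfolding P_def by (rule conjunct1)
    then show "card T < Suc (card I)" using card_mono[OF fI] by (simp add: less_Suc_eq_le)
  qed
  ultimately have "\<exists>T. P T \<and> (\<forall>T'. P T' \<longrightarrow> card T' \<le> card T)"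
    by (rule ex_has_greatest_nat)
  then obtain T where T: "P T" and max: "\<And>T'. P T' \<Longrightarrow> card T' \<le> card T" by blast
  have TI: "T \<subseteq> I" and eT: "e * card T \<le> card (\<Union> (N ` T))" using T by (auto simp: P_def)
  have fT: "finite T" using TI fI finite_subset by blast
  have NU: "\<Union> (N ` T) \<subseteq> U" using TI IV N by blast
  then have fN: "finite (\<Union> (N ` T))" using fin finite_subset by blast
  have "card (N v - \<Union> (N ` T)) < e" if v: "v \<in> I" for v
  proof (rule ccontr)
    assume big: "\<not> card (N v - \<Union> (N ` T)) < e"
    have "v \<notin> T"
    proof
      assume "v \<in> T"
      then have "N v - \<Union> (N ` T) = {}" by auto
      then show False using big e by (metis card.empty)
    qed
    have "N v \<subseteq> U" using N v IV by blast
    then have fv: "finite (N v - \<Union> (N ` T))" using fin finite_subset by blast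
    have "\<Union> (N ` insert v T) = \<Union> (N ` T) \<union> (N v - \<Union> (N ` T))" by auto
    then have "card (\<Union> (N ` insert v T)) = card (\<Union> (N ` T)) + card (N v - \<Union> (N ` T))"
      using fN fv by (metis Diff_disjoint card_Un_disjoint)
    then have "e * card (insert v T) \<le> card (\<Union> (N ` insert v T))"
      using eT big fT \<open>v \<notin> T\<close> by simp
    then have "P (insert v T)" using v TI unfolding P_def by blast
    then show False using max[of "insert v T"] fT \<open>v \<notin> T\<close> by simp
  qed
  moreover have "v \<notin> \<Union> (N ` T)" if "v \<in> I" for v using that indep TI by blast
  ultimately have "I \<subseteq> container N V e T" using IV by (auto simp: container_def)
  moreover have "e * card T \<le> card U" using eT card_mono[OF fin NU] by linarith
  ultimately show ?thesis using that TI by blast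
qed

text \<open>Cut the positive integers into blocks of length \<open>L\<close> and let
  \<open>y\<close> be the end of the last block with at least \<open>d\<close> elements of
  \<open>H\<close>, or 0 if there is none. Every later block is poor, and only boundedly many of
  them meet \<open>{..F}\<close>.\<close>

lemma obtain_last_rich_block:
  fixes H :: "nat set"
  assumes H: "H \<subseteq> {..F}" and L: "L > 0" and d: "d > 0"
  obtains y where "card (H \<inter> {y<..}) \<le> d * (F div L + 1)"
    "y > 0 \<Longrightarrow> L \<le> y \<and> d \<le> card (H \<inter> {y - L<..y})"
proof -
  define blk where "blk b = {b * L<..(b + 1) * L}" for b
  define P where "P B \<longleftrightarrow> (\<forall>b\<ge>B. card (H \<inter> blk b) < d)" for B
  have "P (F + 1)"
    unfolding P_def
  proof (intro allI impI)
    fix b assume "b \<ge> F + 1"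
    then have "F + 1 \<le> b * 1" by simp
    also have "\<dots> \<le> b * L" using L by (intro mult_le_mono2) simp
    finally have "F + 1 \<le> b * L" .
    then have "H \<inter> blk b = {}" using H by (fastforce simp: blk_def)
    then show "card (H \<inter> blk b) < d" using d by simp
  qed
  define B where "B = (LEAST B. P B)"
  have PB: "P B" unfolding B_def using \<open>P (F + 1)\<close> by (rule LeastI)
  have "H \<inter> {B * L<..} \<subseteq> (\<Union>b\<in>{B..F div L}. H \<inter> blk b)"
  proof
    fix h assume h: "h \<in> H \<inter> {B * L<..}"
    \<comment> \<open>Blocks are open on the left, so the last point of a block must be shifted by
      one to get the right index.\<close>
    define b where "b = (h - 1) div L"
    have "b * L \<le> h - 1" "h - 1 < (b + 1) * L"
      unfolding b_def using L dividend_less_div_times[OF L, of "h - 1"] by auto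
    then have "h \<in> blk b" using h by (auto simp: blk_def)
    moreover have "b \<ge> B" 
    proof -
      have "B * L \<le> h - 1" using h by (simp, linarith)
      then show ?thesis unfolding b_def using L by (simp add: less_eq_div_iff_mult_less_eq)
    qed
    moreover have "b \<le> F div L" unfolding b_def using h H by (intro div_le_mono) fastforce
    ultimately show "h \<in> (\<Union>b\<in>{B..F div L}. H \<inter> blk b)" using h by auto
  qed
  then have "card (H \<inter> {B * L<..}) \<le> card (\<Union>b\<in>{B..F div L}. H \<inter> blk b)"
    by (rule card_mono[rotated]) (auto simp: blk_def)
  also have "\<dots> \<le> (\<Sum>b\<in>{B..F div L}. card (H \<inter> blk b))" by (rule card_UN_le) auto
  also have "\<dots> \<le> (\<Sum>b\<in>{B..F div L}. d)"
    using PB by (intro sum_mono) (auto simp: P_def less_imp_le)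
  also have "\<dots> \<le> d * (F div L + 1)"
  proof -
    have "card {B..F div L} \<le> F div L + 1" by simp
    then have "d * card {B..F div L} \<le> d * (F div L + 1)" by (rule mult_le_mono2)
    then show ?thesis by (simp only: sum_constant mult.commute[of d] of_nat_id)
  qed
  finally have "card (H \<inter> {B * L<..}) \<le> d * (F div L + 1)" .
  moreover have "L \<le> B * L \<and> d \<le> card (H \<inter> {B * L - L<..B * L})" if pos: "B * L > 0"
  proof -
    obtain B' where B': "B = Suc B'" using pos by (cases B) auto
    have "\<not> P B'" using B' not_less_Least[of B' P] unfolding B_def by simp
    then obtain b where b: "b \<ge> B'" "d \<le> card (H \<inter> blk b)" by (auto simp: P_def not_less)
    moreover have "\<not> b \<ge> B" using PB b by (auto simp: P_def not_less)
    ultimately have "b = B'" by (simp add: B')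
    then have "d \<le> card (H \<inter> blk B')" using b by simp
    then show ?thesis by (simp add: B' blk_def)
  qed
  ultimately show ?thesis by (rule that)
qed

subsection \<open>Weights of sets closed under adding the multiplicity\<close>

text \<open>The trace on \<open>R\<close> of a semigroup containing \<open>m\<close> is of this
  kind. Closure is asked only inside \<open>R\<close>, so members of a residue class outside
  \<open>R\<close> are skipped.\<close>

definition upclosed :: "nat \<Rightarrow> nat set \<Rightarrow> nat set set" where
  "upclosed m R = {X. X \<subseteq> R \<and> (\<forall>i\<in>X. \<forall>j\<in>R. i \<le> j \<and> i mod m = j mod m \<longrightarrow> j \<in> X)}"

lemma finite_upclosed: "finite R \<Longrightarrow> finite (upclosed m R)"
  unfolding upclosed_def by (rule finite_subset[of _ "Pow R"]) auto

lemma sum_psi_subsets: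
  assumes "finite R"
  shows "(\<Sum>X\<in>Pow R. psi ^ card (R - X)) = (1 + psi) ^ card R"
  using assms
proof (induction R)
  case (insert r R)
  have "(\<Sum>X\<in>Pow (insert r R). psi ^ card (insert r R - X))
      = (\<Sum>X\<in>Pow R. psi ^ card (insert r R - X)) + (\<Sum>X\<in>insert r ` Pow R. psi ^ card (insert r R - X))"
    using insert.hyps by (subst Pow_insert, intro sum.union_disjoint) auto
  also have "(\<Sum>X\<in>insert r ` Pow R. psi ^ card (insert r R - X)) = (\<Sum>X\<in>Pow R. psi ^ card (R - X))"
  proof (subst sum.reindex)
    show "inj_on (insert r) (Pow R)"
      using insert.hyps by (intro inj_onI) (metis Diff_insert_absorb PowD subsetD)
    show "sum ((\<lambda>X. psi ^ card (insert r R - X)) \<circ> insert r) (Pow R) = (\<Sum>X\<in>Pow R. psi ^ card (R - X))"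
      using insert.hyps by (intro sum.cong) (auto intro!: arg_cong[of _ _ "\<lambda>A. psi ^ card A"])
  qed
  also have "(\<Sum>X\<in>Pow R. psi ^ card (insert r R - X)) = psi * (\<Sum>X\<in>Pow R. psi ^ card (R - X))"
    unfolding sum_distrib_left
  proof (rule sum.cong)
    fix X assume "X \<in> Pow R"
    then have "insert r R - X = insert r (R - X)" "r \<notin> R - X" using insert.hyps by auto
    then show "psi ^ card (insert r R - X) = psi * psi ^ card (R - X)"
      using insert.hyps by simp
  qed auto
  finally show ?case using insert by (simp add: algebra_simps)
qed auto

text \<open>Without the closure condition the factor would be \<open>1 + psi\<close>. If \<open>v \<in> X\<close>, then the next
  element \<open>w0\<close> of its class lies in \<open>X\<close>, and deleting \<open>w0\<close> from such sets shows that they carry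
  at most the share \<open>psi\<close> of the total weight.\<close>

lemma sum_psi_upclosed_insert_le:
  assumes fin: "finite R" and v: "\<And>r. r \<in> R \<Longrightarrow> v < r" and w: "w \<in> R" "w mod m = v mod m"
  shows "(\<Sum>X\<in>upclosed m (insert v R). psi ^ card (insert v R - X))
       \<le> 2 * psi * (\<Sum>X\<in>upclosed m R. psi ^ card (R - X))"
proof -
  define w0 where "w0 = (LEAST r. r \<in> R \<and> r mod m = v mod m)"
  have w0: "w0 \<in> R" "w0 mod m = v mod m"
    using LeastI[of "\<lambda>r. r \<in> R \<and> r mod m = v mod m" w] w by (auto simp: w0_def)
  have w0_le: "w0 \<le> r" if "r \<in> R" "r mod m = v mod m" for r
    unfolding w0_def using that by (intro Least_le) auto
  have vR: "v \<notin> R" using v by blast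
  define A where "A = {X \<in> upclosed m R. w0 \<in> X}"
  define A' where "A' = {X \<in> upclosed m R. w0 \<notin> X}"
  define f where "f X = psi ^ card (R - X)" for X
  have finU: "finite (upclosed m R)" using fin by (rule finite_upclosed)
  have split: "sum f (upclosed m R) = sum f A + sum f A'"
  proof -
    have "upclosed m R = A \<union> A'" by (auto simp: A_def A'_def)
    moreover have "A \<inter> A' = {}" by (auto simp: A_def A'_def)
    ultimately show ?thesis using finU by (simp add: sum.union_disjoint)
  qed
  have f0: "f X \<ge> 0" for X using psi_pos by (simp add: f_def)
  \<comment> \<open>Deleting \<open>w0\<close> creates one more gap, hence multiplies the weight by
    \<open>psi\<close>.\<close>
  have "psi * sum f A \<le> sum f A'"
  proof -
    have inj: "inj_on (\<lambda>X. X - {w0}) A" by (intro inj_onI) (auto simp: A_def)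
    have "psi * sum f A = (\<Sum>X\<in>A. f (X - {w0}))"
      unfolding sum_distrib_left
    proof (rule sum.cong)
      fix X assume X: "X \<in> A"
      then have "R - (X - {w0}) = insert w0 (R - X)" "w0 \<notin> R - X" using w0 by (auto simp: A_def)
      then show "psi * f X = f (X - {w0})" using fin by (simp add: f_def)
    qed auto
    also have "\<dots> = sum f ((\<lambda>X. X - {w0}) ` A)" using inj by (simp add: sum.reindex)
    also have "\<dots> \<le> sum f A'"
    proof (rule sum_mono2)
      show "finite A'" using finU by (simp add: A'_def)
      show "(\<lambda>X. X - {w0}) ` A \<subseteq> A'"
      proof clarify
        fix X assume X: "X \<in> A"
        \<comment> \<open>The deletion keeps the set closed because \<open>w0\<close> is the least
          element of its class in \<open>R\<close>: nothing below it can force it.\<close>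
        have "j \<noteq> w0" if "i \<in> X" "i \<noteq> w0" "j \<in> R" "i \<le> j" "i mod m = j mod m" for i j
        proof
          assume "j = w0"
          then have "w0 \<le> i" using that X w0 by (intro w0_le) (auto simp: A_def upclosed_def)
          then show False using that \<open>j = w0\<close> by simp
        qed
        then show "X - {w0} \<in> A'" using X by (auto simp: A_def A'_def upclosed_def)
      qed
    qed (use f0 in auto)
    finally show ?thesis .
  qed
  with split have "(1 + psi) * sum f A \<le> sum f (upclosed m R)" by (simp add: algebra_simps)
  then have "psi * ((1 + psi) * sum f A) \<le> psi * sum f (upclosed m R)"
    using psi_pos by (intro mult_left_mono) auto
  then have A_le: "sum f A \<le> psi * sum f (upclosed m R)"
    by (simp only: mult.assoc[symmetric] psi_eq mult_1_left)
  define g where "g X = psi ^ card (insert v R - X)" for X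
  \<comment> \<open>Sets without \<open>v\<close> pay \<open>psi\<close> for the gap; sets with
    \<open>v\<close> must contain \<open>w0\<close> and carry the weight of \<open>A\<close>. Both
    parts are at most \<open>psi\<close> times the old total.\<close>
  have sub: "upclosed m (insert v R) \<subseteq> upclosed m R \<union> insert v ` A"
  proof
    fix X assume X: "X \<in> upclosed m (insert v R)"
    show "X \<in> upclosed m R \<union> insert v ` A"
    proof (cases "v \<in> X")
      case False
      then have "X \<in> upclosed m R" using X by (auto simp: upclosed_def)
      then show ?thesis by simp
    next
      case True
      have "w0 \<in> X" using X True w0 v[of w0] by (auto simp: upclosed_def)
      moreover have "X - {v} \<in> upclosed m R"
        using X vR by (auto simp: upclosed_def)
      ultimately have "X - {v} \<in> A" using vR w0 by (auto simp: A_def)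
      moreover have "X = insert v (X - {v})" using True by auto
      ultimately show ?thesis by blast
    qed
  qed
  have "sum g (upclosed m (insert v R)) \<le> sum g (upclosed m R \<union> insert v ` A)"
    using sub finU psi_pos by (intro sum_mono2) (auto simp: A_def g_def)
  also have "\<dots> = sum g (upclosed m R) + sum g (insert v ` A)"
  proof (rule sum.union_disjoint)
    show "finite (insert v ` A)" using finU by (simp add: A_def)
    show "upclosed m R \<inter> insert v ` A = {}" using vR by (auto simp: upclosed_def)
  qed (rule finU)
  also have "sum g (insert v ` A) = sum f A"
  proof (subst sum.reindex)
    have "v \<notin> X" if "X \<in> A" for X using that vR by (auto simp: A_def upclosed_def)
    then show "inj_on (insert v) A" by (intro inj_onI) (metis Diff_insert_absorb)
    show "sum (g \<circ> insert v) A = sum f A"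
      using vR by (intro sum.cong) (auto simp: f_def g_def intro!: arg_cong[of _ _ "\<lambda>A. psi ^ card A"])
  qed
  also have "sum g (upclosed m R) = psi * sum f (upclosed m R)"
    unfolding sum_distrib_left
  proof (rule sum.cong)
    fix X assume "X \<in> upclosed m R"
    then have "insert v R - X = insert v (R - X)" using vR by (auto simp: upclosed_def)
    then show "g X = psi * f X" using vR fin by (simp add: f_def g_def)
  qed auto
  finally have "sum g (upclosed m (insert v R)) \<le> 2 * psi * sum f (upclosed m R)"
    using A_le by linarith
  then show ?thesis by (simp only: f_def[abs_def] g_def[abs_def])
qed

text \<open>Positions of \<open>C\<close> are added from the largest down. Each has a later member
  of its class in \<open>R\<close>, so it costs \<open>2 * psi\<close> instead of
  \<open>1 + psi\<close>.\<close>

lemma sum_psi_upclosed_le: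
  assumes fC: "finite C" and fR: "finite R"
    and CR: "\<And>c r. c \<in> C \<Longrightarrow> r \<in> R \<Longrightarrow> c < r"
    and hit: "\<And>c. c \<in> C \<Longrightarrow> \<exists>r\<in>R. r mod m = c mod m"
  shows "(\<Sum>X\<in>upclosed m (C \<union> R). psi ^ card (C \<union> R - X)) \<le> (2 * psi) ^ card C * (1 + psi) ^ card R"
  using fC CR hit
proof (induction C rule: finite_linorder_min_induct)
  case empty
  have "(\<Sum>X\<in>upclosed m R. psi ^ card (R - X)) \<le> (\<Sum>X\<in>Pow R. psi ^ card (R - X))"
  proof (rule sum_mono2)
    show "upclosed m R \<subseteq> Pow R" by (auto simp: upclosed_def)
  qed (use fR psi_pos in auto)
  then show ?case using sum_psi_subsets[OF fR] by simp
next
  case (insert v C)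
  obtain r where r: "r \<in> R" "r mod m = v mod m" using insert.prems by blast
  have "(\<Sum>X\<in>upclosed m (insert v (C \<union> R)). psi ^ card (insert v (C \<union> R) - X))
       \<le> 2 * psi * (\<Sum>X\<in>upclosed m (C \<union> R). psi ^ card (C \<union> R - X))"
    by (rule sum_psi_upclosed_insert_le[of _ _ r]) (use insert.hyps insert.prems fR r in auto)
  also have "\<dots> \<le> 2 * psi * ((2 * psi) ^ card C * (1 + psi) ^ card R)"
    using insert.IH insert.prems psi_pos by (intro mult_left_mono) auto
  also have "\<dots> = (2 * psi) ^ card (insert v C) * (1 + psi) ^ card R"
  proof -
    have "v \<notin> C" using insert.hyps by blast
    then show ?thesis using insert.hyps by simp
  qed
  finally show ?case by simp
qed


subsection \<open>Semigroups of given multiplicity, Frobenius number and genus\<close>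

text \<open>Fixing the multiplicity \<open>m\<close> and the Frobenius number \<open>F\<close>
  splits the failing semigroups into polynomially many classes, each of which can be bounded
  separately.\<close>

definition semis :: "nat \<Rightarrow> nat \<Rightarrow> nat \<Rightarrow> nat set set" where
  "semis m F g = {S. numerical_semigroup S \<and> genus S = g \<and> 0 < m \<and> m \<in> S \<and>
     (\<forall>i. 0 < i \<and> i < m \<longrightarrow> i \<notin> S) \<and> F \<notin> S \<and> (\<forall>i>F. i \<in> S)}"

lemma semisD:
  assumes "S \<in> semis m F g"
  shows "numerical_semigroup S" "genus S = g" "0 < m" "m \<in> S" "\<And>i. 0 < i \<Longrightarrow> i < m \<Longrightarrow> i \<notin> S"
    "F \<notin> S" "\<And>i. F < i \<Longrightarrow> i \<in> S" "0 \<in> S" "\<And>x y. x \<in> S \<Longrightarrow> y \<in> S \<Longrightarrow> x + y \<in> S"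
    "finite (gaps S)" "card (gaps S) = g" "0 < F" "gaps S \<subseteq> {..F}"
  using assms by (auto simp: semis_def numerical_semigroup_def gaps_def genus_def not_le intro!: gr0I)

lemma finite_semis: "finite (semis m F g)"
  by (rule finite_subset[OF _ finite_semigroups_genus[of g]]) (auto simp: semis_def)

section \<open>Weighted counting over the pairs \<open>(i, F - i)\<close>\<close>

definition pair_weight :: "real \<Rightarrow> bool \<times> bool \<Rightarrow> real" where
  "pair_weight x p = x ^ (of_bool (\<not> fst p) + of_bool (\<not> snd p))"

text \<open>A semigroup of the class is determined by its patterns on the pairs. The pairs see at
  most \<open>g\<close> gaps, so its weight is at least \<open>x ^ g\<close>. Summing over all
  choices from the allowed patterns \<open>B i\<close> turns the total into a product of local
  sums.\<close>

lemma card_semis_pairs_le: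
  fixes x :: real
  assumes x: "0 < x" "x \<le> 1" and \<Omega>: "\<Omega> \<subseteq> semis m F g"
    and B: "\<And>S i. S \<in> \<Omega> \<Longrightarrow> 0 < i \<Longrightarrow> 2 * i < F \<Longrightarrow> (i \<in> S, F - i \<in> S) \<in> B i"
  shows "real (card \<Omega>) * x ^ g \<le> (\<Prod>i\<in>{1..<(F + 1) div 2}. \<Sum>b\<in>B i. pair_weight x b)"
proof -
  define P where "P = {1..<(F + 1) div 2}"
  have P: "i \<in> P \<longleftrightarrow> 0 < i \<and> 2 * i < F" for i unfolding P_def by auto
  have finP: "finite P" by (simp add: P_def)
  have fB: "finite (B i)" for i by (rule finite_subset[OF subset_UNIV]) simp
  define h where "h S = restrict (\<lambda>i. (i \<in> S, F - i \<in> S)) P" for S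
  have fin: "finite \<Omega>" using \<Omega> finite_semis finite_subset by blast
  have hB: "h S \<in> PiE P B" if "S \<in> \<Omega>" for S using B that by (auto simp: h_def P)
  have inj: "inj_on h \<Omega>"
  proof (rule inj_onI)
    fix S S' assume S: "S \<in> \<Omega>" "S' \<in> \<Omega>" and eq: "h S = h S'"
    then have SS: "S \<in> semis m F g" "S' \<in> semis m F g" using \<Omega> by auto
    \<comment> \<open>The midpoint \<open>F / 2\<close> belongs to no pair, but it is always a gap
      because its double is \<open>F\<close>.\<close>
    have mid: "i \<notin> T" if "T \<in> semis m F g" "2 * i = F" for i T
      using semisD(9)[OF that(1), of i i] semisD(6)[OF that(1)] that(2) by (auto simp: mult_2)
    have eq': "i \<in> S \<longleftrightarrow> i \<in> S'" "F - i \<in> S \<longleftrightarrow> F - i \<in> S'" if "i \<in> P" for i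
      using fun_cong[OF eq, of i] that by (auto simp: h_def)
    show "S = S'"
    proof (rule set_eqI)
      fix i
      consider "i = 0" | "i = F" | "i > F" | "2 * i = F" | "i \<in> P" | "F - i \<in> P" "F - (F - i) = i"
        unfolding P by linarith
      then show "i \<in> S \<longleftrightarrow> i \<in> S'"
      proof cases
        case 6
        then show ?thesis using eq'(2)[of "F - i"] by simp
      qed (use SS[THEN semisD(8)] SS[THEN semisD(6)] SS[THEN semisD(7)] eq'(1)
             mid[OF SS(1)] mid[OF SS(2)] in auto)
    qed
  qed
  have weight: "x ^ g \<le> (\<Prod>i\<in>P. pair_weight x (h S i))" if S: "S \<in> \<Omega>" for S
  proof -
    have SS: "S \<in> semis m F g" using S \<Omega> by auto
    define A where "A = {i \<in> P. i \<notin> S}"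
    define A' where "A' = {i \<in> P. F - i \<notin> S}"
    have "A \<inter> (\<lambda>i. F - i) ` A' = {}" by (auto simp: A_def A'_def P)
    moreover have "inj_on (\<lambda>i. F - i) A'" by (auto simp: A'_def P intro!: inj_onI)
    ultimately have "card A + card A' = card (A \<union> (\<lambda>i. F - i) ` A')"
      using finP by (simp add: card_Un_disjoint card_image A_def A'_def)
    also have "\<dots> \<le> card (gaps S)"
      using semisD(10)[OF SS] by (rule card_mono) (auto simp: A_def A'_def gaps_def)
    finally have le: "card A + card A' \<le> g" using semisD(11)[OF SS] by simp
    have "(\<Prod>i\<in>P. pair_weight x (h S i)) = x ^ (\<Sum>i\<in>P. of_bool (i \<notin> S) + of_bool (F - i \<notin> S))"
      by (simp add: pair_weight_def h_def power_sum)
    also have "(\<Sum>i\<in>P. of_bool (i \<notin> S) + of_bool (F - i \<notin> S) :: nat) = card A + card A'"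
      using finP by (simp add: sum.distrib A_def A'_def Int_def)
    finally show ?thesis using x le by (simp add: power_decreasing)
  qed
  have "real (card \<Omega>) * x ^ g = (\<Sum>S\<in>\<Omega>. x ^ g)" by simp
  also have "\<dots> \<le> (\<Sum>S\<in>\<Omega>. \<Prod>i\<in>P. pair_weight x (h S i))" by (rule sum_mono) (rule weight)
  also have "\<dots> = (\<Sum>f\<in>h ` \<Omega>. \<Prod>i\<in>P. pair_weight x (f i))" using inj by (simp add: sum.reindex)
  also have "\<dots> \<le> (\<Sum>f\<in>PiE P B. \<Prod>i\<in>P. pair_weight x (f i))"
    using hB finP fB x by (intro sum_mono2 finite_PiE prod_nonneg) (auto simp: pair_weight_def)
  also have "\<dots> = (\<Prod>i\<in>P. \<Sum>b\<in>B i. pair_weight x b)"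
    using finP fB by (subst prod_sum_PiE) auto
  finally show ?thesis unfolding P_def .
qed

lemma semis_pair:
  assumes "S \<in> semis m F g" "2 * i < F" "i \<in> S"
  shows "F - i \<notin> S"
  using semisD(9)[OF assms(1) assms(3), of "F - i"] semisD(6)[OF assms(1)] assms(2) by auto

lemma prod_power_if:
  fixes a :: "'a :: comm_semiring_1"
  assumes "finite P"
  shows "(\<Prod>i\<in>P. if Q i then a else 1) = a ^ card {i \<in> P. Q i}"
  using assms by (simp add: prod.If_cases Int_def)

text \<open>A pair with \<open>i < m\<close> has weight sum \<open>1/2 + 1/4 = 3/4\<close>. For
  \<open>i\<close> at least \<open>m\<close> one further pattern raises this to
  \<open>5/4 = 3/4 * 5/3\<close>; there are few such pairs when \<open>F - 2 * m\<close> is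
  small.\<close>

lemma card_semis_half_weight_le:
  "real (card (semis m F g)) * (1/2) ^ g
     \<le> (3/4) ^ ((F + 1) div 2 - 1) * (5/3) ^ ((F + 1) div 2 - m)"
proof (cases "m > 0")
  case False
  then have "semis m F g = {}" by (auto simp: semis_def)
  then show ?thesis by simp
next
  case m: True
  define P where "P = {1..<(F + 1) div 2}"
  define B where "B i = (if i < m then {(False, True), (False, False)}
                         else {(True, False), (False, True), (False, False)})" for i
  have "real (card (semis m F g)) * (1/2) ^ g \<le> (\<Prod>i\<in>P. \<Sum>b\<in>B i. pair_weight (1/2) b)"
    unfolding P_def
    by (rule card_semis_pairs_le) (use semis_pair in \<open>auto simp: B_def semisD(5)\<close>)
  also have "\<dots> = (\<Prod>i\<in>P. 3/4 * (if m \<le> i then 5/3 else 1))"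
    by (intro prod.cong) (auto simp: B_def pair_weight_def power2_eq_square)
  also have "\<dots> = (3/4) ^ card P * (5/3) ^ card {i \<in> P. m \<le> i}"
    unfolding P_def by (simp only: prod.distrib prod_power_if prod_constant finite_atLeastLessThan)
  also have "{i \<in> P. m \<le> i} = {m..<(F + 1) div 2}" using m by (auto simp: P_def)
  finally show ?thesis by (simp add: P_def)
qed

text \<open>If \<open>F - i > y\<close> and \<open>F - i \<notin> G\<close>, then \<open>F - i\<close> is in \<open>S\<close> and hence \<open>i\<close> is not: the pair has weight
  \<open>psi\<close>. Any other pair has weight 1 if \<open>i < m\<close> and at most \<open>1 / psi\<close> if \<open>m \<le> i\<close>, and as \<open>F - y\<close> is
  large there are too few of the latter to compensate.\<close>

lemma card_semis_sparse_top_le: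
  assumes F: "2 * m + 4 * k \<le> F" and y: "y < 2 * m + k" and G: "finite G"
  shows "real (card {S \<in> semis m F g. gaps S \<inter> {y<..} = G}) * psi ^ g * psi ^ (card G + 1) \<le> psi ^ k"
proof -
  define \<Omega> where "\<Omega> = {S \<in> semis m F g. gaps S \<inter> {y<..} = G}"
  show ?thesis
  proof (cases "m > 0")
    case False
    then have "semis m F g = {}" by (auto simp: semis_def)
    then show ?thesis using psi_pos by simp
  next
    case m: True
    define P where "P = {1..<(F + 1) div 2}"
    define p where "p = (F + 1) div 2"
    define B where "B i = (if y < F - i then
          (if F - i \<in> G then {(True, False), (False, False)} else {(False, True)})
        else if i < m then {(False, True), (False, False)}
        else {(True, False), (False, True), (False, False)})" for i
    \<comment> \<open>\<open>Q1\<close> marks pairs with \<open>F - i\<close> above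
      \<open>y\<close>, worth \<open>psi\<close>; \<open>Q2\<close> marks the exceptions, where
      \<open>F - i\<close> is a gap in \<open>G\<close>; \<open>Q3\<close> marks the remaining pairs
      with both halves free, worth \<open>2 * psi + psi ^ 2 = 1 / psi\<close>.\<close>
    define Q1 where "Q1 i \<longleftrightarrow> i < F - y" for i
    define Q2 where "Q2 i \<longleftrightarrow> F - i \<in> G" for i
    define Q3 where "Q3 i \<longleftrightarrow> m \<le> i \<and> F - y \<le> i" for i
    define c where "c Q = card {i \<in> P. Q i}" for Q :: "nat \<Rightarrow> bool"
    have phi: "1 + psi = 1 / psi" using psi_eq psi_pos by (simp add: field_simps)
    have psi2: "psi + psi\<^sup>2 = 1" using psi_eq by (simp add: algebra_simps power2_eq_square)
    have psi1: "psi \<le> 1" using psi_less by simp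
    have "real (card \<Omega>) * psi ^ g \<le> (\<Prod>i\<in>P. \<Sum>b\<in>B i. pair_weight psi b)"
      unfolding P_def
    proof (rule card_semis_pairs_le)
      fix S i assume S: "S \<in> \<Omega>" and i: "0 < i" "2 * i < F"
      then have SS: "S \<in> semis m F g" by (simp add: \<Omega>_def)
      have "F - i \<in> G \<longleftrightarrow> F - i \<notin> S" if "y < F - i"
        using S that by (auto simp: \<Omega>_def gaps_def)
      then show "(i \<in> S, F - i \<in> S) \<in> B i"
        using semis_pair[OF SS i(2)] semisD(5)[OF SS i(1)] by (auto simp: B_def)
    qed (use psi_pos psi1 in \<open>auto simp: \<Omega>_def\<close>)
    also have "\<dots> \<le> (\<Prod>i\<in>P. (if Q1 i then psi else 1) * ((if Q2 i then 1 / psi else 1)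
                                                   * (if Q3 i then 1 / psi else 1)))"
    proof (rule prod_mono)
      fix i assume i: "i \<in> P"
      then have iF: "2 * i < F" by (auto simp: P_def)
      have Q1: "Q1 i \<longleftrightarrow> y < F - i" using iF by (auto simp: Q1_def)
      have Q3: "Q3 i \<longleftrightarrow> m \<le> i \<and> \<not> Q1 i" by (auto simp: Q3_def Q1_def)
      have sq: "2 * psi + psi\<^sup>2 = 1 / psi" using psi2 phi by simp
      have ge: "1 \<le> 1 / psi" using psi_pos psi1 by simp
      have "(\<Sum>b\<in>B i. pair_weight psi b) \<le> (if Q1 i then psi else 1) * ((if Q2 i then 1 / psi else 1)
                                                   * (if Q3 i then 1 / psi else 1))"
      proof (cases "Q1 i")
        case True
        then show ?thesis using psi2 psi_pos unfolding Q3
          by (simp add: B_def Q1[symmetric] Q2_def pair_weight_def power2_eq_square)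
      next
        case False
        have "(\<Sum>b\<in>B i. pair_weight psi b) = (if Q3 i then 1 / psi else 1)"
          using False psi2 sq unfolding Q3
          by (simp add: B_def Q1[symmetric] pair_weight_def power2_eq_square)
        also have "\<dots> \<le> (if Q2 i then 1 / psi else 1) * (if Q3 i then 1 / psi else 1)"
          using mult_right_mono[OF ge, of "1 / psi"] ge psi_pos by simp
        finally show ?thesis using False by simp
      qed
      moreover have "0 \<le> (\<Sum>b\<in>B i. pair_weight psi b)"
        using psi_pos by (intro sum_nonneg) (simp add: pair_weight_def)
      ultimately show "0 \<le> (\<Sum>b\<in>B i. pair_weight psi b) \<and> (\<Sum>b\<in>B i. pair_weight psi b)
        \<le> (if Q1 i then psi else 1) * ((if Q2 i then 1 / psi else 1) * (if Q3 i then 1 / psi else 1))"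
        by simp
    qed
    also have "\<dots> = psi ^ c Q1 * ((1 / psi) ^ c Q2 * (1 / psi) ^ c Q3)"
      unfolding c_def by (simp only: prod.distrib prod_power_if P_def finite_atLeastLessThan)
    also have "\<dots> = psi ^ c Q1 / psi ^ (c Q2 + c Q3)"
      by (simp add: power_add power_one_over)
    finally have le: "real (card \<Omega>) * psi ^ g * psi ^ (c Q2 + c Q3) \<le> psi ^ c Q1"
      using psi_pos by (simp add: pos_le_divide_eq)
    have "c Q2 \<le> card G"
      unfolding c_def
    proof (rule card_inj_on_le)
      show "inj_on (\<lambda>i. F - i) {i \<in> P. Q2 i}" by (auto simp: P_def intro!: inj_onI)
      show "(\<lambda>i. F - i) ` {i \<in> P. Q2 i} \<subseteq> G" by (auto simp: Q2_def)
    qed (rule G)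
    moreover have "c Q1 = min (F - y) p - 1"
    proof -
      have "{i \<in> P. Q1 i} = {1..<min (F - y) p}" by (auto simp: P_def Q1_def p_def)
      then show ?thesis by (simp add: c_def)
    qed
    moreover have "c Q3 = p - max m (F - y)"
    proof -
      have "{i \<in> P. Q3 i} = {max m (F - y)..<p}" using m by (auto simp: P_def Q3_def p_def)
      then show ?thesis by (simp add: c_def)
    qed
    moreover have "2 * p \<le> F + 1" "F \<le> 2 * p" by (auto simp: p_def)
    \<comment> \<open>Let \<open>a = F - 2 * m\<close>. In the critical case there are at least
      \<open>a - k\<close> favourable pairs against at most \<open>(a + 1) / 2\<close> unfavourable
      ones; the surplus reaches \<open>k\<close>, up to one unit, because \<open>a\<close> is at
      least \<open>4 * k\<close>.\<close>
    then have "k + (p - max m (F - y)) \<le> min (F - y) p - 1 + 1"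
      using F y m by (simp add: min_def max_def) linarith
    ultimately have "k + (c Q2 + c Q3) \<le> c Q1 + (card G + 1)" by linarith
    then have "psi ^ c Q1 * psi ^ (card G + 1) \<le> psi ^ k * psi ^ (c Q2 + c Q3)"
      unfolding power_add[symmetric] using psi_pos psi1 by (intro power_decreasing) auto
    moreover have "real (card \<Omega>) * psi ^ g * psi ^ (c Q2 + c Q3) * psi ^ (card G + 1)
        \<le> psi ^ c Q1 * psi ^ (card G + 1)"
      using le psi_pos by (intro mult_right_mono) auto
    ultimately have "(real (card \<Omega>) * psi ^ g * psi ^ (card G + 1)) * psi ^ (c Q2 + c Q3)
        \<le> psi ^ k * psi ^ (c Q2 + c Q3)" by (simp add: mult_ac)
    then show ?thesis using psi_pos unfolding \<Omega>_def by (simp add: mult_le_cancel_right)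
  qed
qed


text \<open>Given \<open>G\<close>, the semigroup is determined by its trace on \<open>C\<close> and
  on the last \<open>m + L\<close> positions up to \<open>y\<close>. These positions meet every
  class modulo \<open>m\<close>, so each point of \<open>C\<close> costs only
  \<open>2 * psi\<close>. The gaps below \<open>m\<close> cancel the factor \<open>1 + psi\<close>
  of the top positions up to \<open>psi ^ (L + 1)\<close>.\<close>

lemma card_semis_rich_top_le:
  assumes y: "2 * m + L \<le> y" and C: "C \<subseteq> {m..y - m - L}"
  shows "real (card {S \<in> semis m F g. gaps S \<inter> {y<..} = G \<and> S \<inter> {m..y - m - L} \<subseteq> C})
           * psi ^ g * psi ^ (L + 1) \<le> psi ^ card {m..y - m - L} * 2 ^ card C"
proof (cases "m > 0")
  case False
  then have "semis m F g = {}" by (auto simp: semis_def)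
  then show ?thesis using psi_pos by simp
next
  case m: True
  define V where "V = {m..y - m - L}"
  define \<Omega> where "\<Omega> = {S \<in> semis m F g. gaps S \<inter> {y<..} = G \<and> S \<inter> V \<subseteq> C}"
  define Top where "Top = {y - m - L<..y}"
  define R where "R = C \<union> Top"
  have fC: "finite C" using C finite_subset by blast
  have cV: "card C \<le> card V" using card_mono[OF _ C] by (simp add: V_def)
  have fR: "finite R" using fC by (simp add: R_def Top_def)
  have cT: "card Top = m + L" using y by (simp add: Top_def)
  have psi1: "psi \<le> 1" using psi_less by simp
  have inj: "inj_on (\<lambda>S. S \<inter> R) \<Omega>"
  proof (rule inj_onI)
    fix S S' assume S: "S \<in> \<Omega>" "S' \<in> \<Omega>" and eq: "S \<inter> R = S' \<inter> R"
    have rec: "T = insert 0 (T \<inter> R \<union> ({y<..} - G))" if T: "T \<in> \<Omega>" for T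
    proof (rule set_eqI)
      fix i
      have TT: "T \<in> semis m F g" using T by (simp add: \<Omega>_def)
      have "i > y \<Longrightarrow> i \<in> T \<longleftrightarrow> i \<notin> G" using T by (auto simp: \<Omega>_def gaps_def)
      moreover have "i \<in> R" if "i \<in> T" "0 < i" "i \<le> y"
      proof -
        have "m \<le> i" using semisD(5)[OF TT that(2)] that(1) not_le by blast
        then have "i \<in> V \<or> i \<in> Top" using that by (auto simp: V_def Top_def)
        then show ?thesis using T that(1) by (auto simp: \<Omega>_def R_def)
      qed
      moreover have "i \<in> R \<Longrightarrow> i \<le> y" using subsetD[OF C, of i] by (auto simp: R_def Top_def)
      ultimately show "i \<in> T \<longleftrightarrow> i \<in> insert 0 (T \<inter> R \<union> ({y<..} - G))"
        using semisD(8)[OF TT] by (cases "i = 0"; cases "i \<le> y") auto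
    qed
    show "S = S'" using rec[OF S(1)] rec[OF S(2)] eq by metis
  qed
  have up: "S \<inter> R \<in> upclosed m R" if S: "S \<in> \<Omega>" for S
  proof -
    have SS: "S \<in> semis m F g" using S by (simp add: \<Omega>_def)
    have mult: "k * m \<in> S" for k
      by (induction k) (use semisD(4,8,9)[OF SS] in auto)
    have "j \<in> S" if ij: "i \<in> S" "i \<le> j" "i mod m = j mod m" for i j
    proof -
      have "m dvd j - i" using ij(2,3) mod_eq_dvd_iff_nat[of i j m] by simp
      then obtain k where "j - i = k * m" by (metis dvd_def mult.commute)
      then have "j = i + k * m" using ij by simp
      then show ?thesis using semisD(9)[OF SS ij(1) mult] by simp
    qed
    then show ?thesis unfolding upclosed_def by blast
  qed
  have weight: "psi ^ g \<le> psi ^ (m - 1 + (card V - card C)) * psi ^ card (R - S \<inter> R)" if S: "S \<in> \<Omega>" for S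
  proof -
    have SS: "S \<in> semis m F g" using S by (simp add: \<Omega>_def)
    \<comment> \<open>Three disjoint families of gaps. Gaps above \<open>y\<close> are left
      uncounted, which is harmless as \<open>psi\<close> is below 1.\<close>
    have "card {1..<m} + card (V - C) + card (R - S \<inter> R) = card ({1..<m} \<union> (V - C) \<union> (R - S \<inter> R))"
    proof -
      have "{1..<m} \<inter> (V - C) = {}" "({1..<m} \<union> (V - C)) \<inter> (R - S \<inter> R) = {}"
        using C y by (auto simp: V_def R_def Top_def)
      then show ?thesis using fR by (simp add: card_Un_disjoint V_def)
    qed
    also have "\<dots> \<le> card (gaps S)"
    proof (rule card_mono[OF semisD(10)[OF SS]])
      show "{1..<m} \<union> (V - C) \<union> (R - S \<inter> R) \<subseteq> gaps S"
        using semisD(5)[OF SS] S by (auto simp: gaps_def \<Omega>_def)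
    qed
    finally have "m - 1 + (card V - card C) + card (R - S \<inter> R) \<le> g"
      using semisD(11)[OF SS] C fC by (simp add: card_Diff_subset V_def)
    then show ?thesis using psi_pos psi1 by (simp add: power_decreasing flip: power_add)
  qed
  have "real (card \<Omega>) * psi ^ g
      \<le> (\<Sum>S\<in>\<Omega>. psi ^ (m - 1 + (card V - card C)) * psi ^ card (R - S \<inter> R))"
    using sum_mono[OF weight] by simp
  also have "\<dots> = psi ^ (m - 1 + (card V - card C)) * (\<Sum>X\<in>(\<lambda>S. S \<inter> R) ` \<Omega>. psi ^ card (R - X))"
    using inj by (simp add: sum.reindex sum_distrib_left)
  also have "\<dots> \<le> psi ^ (m - 1 + (card V - card C)) * (\<Sum>X\<in>upclosed m R. psi ^ card (R - X))"
    using up psi_pos finite_upclosed[OF fR] by (intro mult_left_mono sum_mono2) auto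
  also have "\<dots> \<le> psi ^ (m - 1 + (card V - card C)) * ((2 * psi) ^ card C * (1 + psi) ^ card Top)"
  proof (rule mult_left_mono)
    have hit: "\<exists>r\<in>Top. r mod m = c mod m" if "c \<in> C" for c
    proof -
      \<comment> \<open>\<open>c + q * m\<close> is the last member of the class of \<open>c\<close>
        not exceeding \<open>y\<close>.\<close>
      define q where "q = (y - c) div m"
      have "c \<le> y - m - L" using that C by auto
      then have cy: "c \<le> y" by simp
      have "q * m \<le> y - c" "y - c < q * m + m"
        using div_mult_mod_eq[of "y - c" m] mod_less_divisor[OF m, of "y - c"] unfolding q_def
        by linarith+
      then have "c + q * m \<in> Top" using cy y m by (auto simp: Top_def)
      then show ?thesis by (intro bexI[of _ "c + q * m"]) auto
    qed
    show "(\<Sum>X\<in>upclosed m R. psi ^ card (R - X)) \<le> (2 * psi) ^ card C * (1 + psi) ^ card Top"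
      unfolding R_def using fC C hit by (intro sum_psi_upclosed_le) (auto simp: Top_def)
  qed (use psi_pos in simp)
  finally have "real (card \<Omega>) * psi ^ g * psi ^ (L + 1)
      \<le> psi ^ (m - 1 + (card V - card C)) * ((2 * psi) ^ card C * (1 + psi) ^ card Top) * psi ^ (L + 1)"
    using psi_pos by (intro mult_right_mono) auto
  also have "\<dots> = 2 ^ card C * psi ^ ((card V - card C) + card C) * (psi ^ (m - 1 + (L + 1)) * (1 + psi) ^ (m + L))"
    by (simp only: cT power_add power_mult_distrib mult_ac)
  also have "psi ^ (m - 1 + (L + 1)) * (1 + psi) ^ (m + L) = 1"
  proof -
    have "m - 1 + (L + 1) = m + L" using m by simp
    then show ?thesis by (simp only: power_mult_distrib[symmetric] psi_eq power_one)
  qed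
  also have "card V - card C + card C = card V" using cV by simp
  finally show ?thesis unfolding \<Omega>_def V_def by (simp add: mult.commute)
qed

section \<open>Classes with large \<open>F - 2 * m\<close>: assembling the container bound\<close>

lemma two_power_le:
  assumes "3 * c \<le> 2 * u"
  shows "(2::real) ^ c \<le> (8/5) ^ u"
proof -
  have "((2::real) ^ c) ^ 3 = 2 ^ (3 * c)" by (simp add: mult.commute flip: power_mult)
  also have "\<dots> \<le> 2 ^ (2 * u)" using assms by (intro power_increasing) auto
  also have "\<dots> = 4 ^ u" by (simp add: power_mult)
  also have "\<dots> \<le> ((8/5) ^ 3) ^ u" by (intro power_mono) (auto simp: power3_eq_cube)
  also have "\<dots> = ((8/5) ^ u) ^ 3" by (simp only: mult.commute flip: power_mult)
  finally show ?thesis by (subst (asm) power_mono_iff) auto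
qed

text \<open>The factor \<open>8/5\<close> is a rational upper bound for \<open>4 powr (1/3)\<close>, and \<open>8/5 * psi < 1\<close>.\<close>

definition rho :: real where "rho = 8/5 * psi"

lemma rho_bounds: "0 < rho" "rho < 1" "psi \<le> rho"
  unfolding rho_def using psi_pos psi_less by auto

text \<open>The semigroups are covered by classes indexed by \<open>(y, G, D, T)\<close>: \<open>y\<close> is the end of the last
  block of length \<open>L\<close> with at least \<open>2 * e\<close> gaps, \<open>G\<close> the set of gaps above \<open>y\<close>, \<open>D\<close> a set of \<open>2 * e\<close>
  gaps in that block, and \<open>T\<close> the fingerprint of a container of the independent set
  \<open>S \<inter> {m..y - m - L}\<close> in the graph joining \<open>v\<close> to \<open>d - v\<close> for \<open>d \<in> D\<close>.\<close>

lemma card_semis_le: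
  assumes F: "2 * m + 4 * k \<le> F" "F \<le> 2 * g" and L: "0 < L" "L \<le> k" and e: "0 < e"
    and K: "K = 2 * e * (2 * g div L + 1)"
  shows "real (card (semis m F g)) * psi ^ g * psi ^ (2 * L + K + 1)
           \<le> real (3 * g + 2) ^ (1 + K + 2 * e + 3 * g div e) * rho ^ k"
proof -
  define Sub where "Sub j = {T. T \<subseteq> {..3 * g} \<and> card T \<le> j}" for j
  define N where "N D v = (\<lambda>d. d - v) ` D" for D and v :: nat
  define A where "A = (\<lambda>(y, G, D, T). let V = {m..y - m - L} in
    if y < 2 * m + k then {S \<in> semis m F g. gaps S \<inter> {y<..} = G}
    else if D \<subseteq> {y - L<..y} \<and> card D = 2 * e \<and> T \<subseteq> V
      then {S \<in> semis m F g. gaps S \<inter> {y<..} = G \<and> S \<inter> V \<subseteq> container (N D) V e T}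
      else {})"
  \<comment> \<open>All positions stay below \<open>3 * g\<close>: a rich block contains a gap, so
    \<open>y < F + L\<close>, while \<open>F\<close> is at most \<open>2 * g\<close> and
    \<open>L\<close> at most \<open>g\<close>.\<close>
  define X where "X = {..3 * g} \<times> Sub K \<times> Sub (2 * e) \<times> Sub (3 * g div e)"
  have fSub: "finite (Sub j)" for j by (simp add: Sub_def)
  have fX: "finite X" by (simp add: X_def fSub)
  have psi1: "psi \<le> 1" using psi_less by simp
  \<comment> \<open>Here \<open>v\<close> is at most \<open>y - L\<close>, which is less than every
    \<open>d\<close> in \<open>D\<close>, so \<open>d - v\<close> is not truncated and distinct
    \<open>d\<close> give distinct neighbours.\<close>
  have N: "N D v \<subseteq> {m..y - m} \<and> card (N D v) = card D"
    if "D \<subseteq> {y - L<..y}" "v \<in> {m..y - m - L}" "2 * m + k \<le> y" for D v y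
  proof
    show "N D v \<subseteq> {m..y - m}" using that L by (fastforce simp: N_def)
    have "inj_on (\<lambda>d. d - v) D"
    proof (rule inj_onI)
      fix a b assume "a \<in> D" "b \<in> D" "a - v = b - v"
      moreover from this have "y - L < a" "y - L < b" using that by auto
      moreover have "v \<le> y - L" using that by auto
      ultimately show "a = b" by linarith
    qed
    then show "card (N D v) = card D" by (simp add: N_def card_image)
  qed
  have VU: "{m..y - m - L} \<subseteq> {m..y - m}" for y by auto
  have cover: "semis m F g \<subseteq> (\<Union>p\<in>X. A p)"
  proof
    fix S assume S: "S \<in> semis m F g"
    have "2 * e > 0" using e by simp
    from obtain_last_rich_block[OF semisD(13)[OF S] L(1) this] obtain y
      where few: "card (gaps S \<inter> {y<..}) \<le> 2 * e * (F div L + 1)"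
        and rich: "y > 0 \<Longrightarrow> L \<le> y \<and> 2 * e \<le> card (gaps S \<inter> {y - L<..y})" by blast
    define G where "G = gaps S \<inter> {y<..}"
    have "F div L \<le> 2 * g div L" using F by (intro div_le_mono) auto
    then have "2 * e * (F div L + 1) \<le> K" unfolding K by (intro mult_le_mono2) simp
    then have G: "G \<in> Sub K"
      using few semisD(13)[OF S] F by (force simp: Sub_def G_def)
    have y3: "y \<le> 3 * g"
    proof (cases "y = 0")
      case False
      then have "card (gaps S \<inter> {y - L<..y}) > 0" using rich e by linarith
      then obtain h where "h \<in> gaps S" "y - L < h" by (metis Int_iff card_gt_0_iff ex_in_conv greaterThanAtMost_iff)
      then have "y < F + L" using semisD(13)[OF S] by fastforce
      then show ?thesis using F L by linarith
    qed simp
    show "S \<in> (\<Union>p\<in>X. A p)"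
    proof (cases "y < 2 * m + k")
      case True
      \<comment> \<open>With \<open>y\<close> this small neither \<open>D\<close> nor a fingerprint
        is needed; both are set to the empty set.\<close>
      then have "(y, G, {}, {}) \<in> X" "S \<in> A (y, G, {}, {})"
        using y3 G S by (auto simp: X_def A_def Sub_def G_def)
      then show ?thesis by blast
    next
      case False
      then have y2: "2 * m + k \<le> y" by simp
      then have "y > 0" using L by linarith
      then obtain D where D: "D \<subseteq> gaps S \<inter> {y - L<..y}" "card D = 2 * e"
        using rich obtain_subset_with_card_n by metis
      define V where "V = {m..y - m - L}"
      \<comment> \<open>Two elements of \<open>S\<close> joined by an edge would sum to the gap
        \<open>d\<close>.\<close>
      have indep: "N D v \<inter> (S \<inter> V) = {}" if v: "v \<in> S \<inter> V" for v
      proof (rule ccontr)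
        assume "N D v \<inter> (S \<inter> V) \<noteq> {}"
        then obtain d where d: "d \<in> D" "d - v \<in> S" by (auto simp: N_def)
        have "v \<le> y - L" using v by (auto simp: V_def)
        moreover have "y - L < d" using D d by auto
        ultimately have "d = v + (d - v)" by simp
        then have "d \<in> S" using semisD(9)[OF S, of v "d - v"] v d by simp
        then show False using D d by (auto simp: gaps_def)
      qed
      obtain T where T: "T \<subseteq> S \<inter> V" "e * card T \<le> card {m..y - m}" "S \<inter> V \<subseteq> container (N D) V e T"
      proof (rule independent_set_container[of "{m..y - m}" "S \<inter> V" V e "N D"])
        show "N D v \<subseteq> {m..y - m}" if "v \<in> V" for v using N[of D y v] D that y2 by (auto simp: V_def)
      qed (use indep e VU in \<open>auto simp: V_def\<close>)
      have "card {m..y - m} \<le> 3 * g" using y3 semisD(3)[OF S] by simp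
      then have "e * card T \<le> 3 * g" using T by linarith
      then have "card T \<le> 3 * g div e" using e by (simp add: less_eq_div_iff_mult_less_eq mult.commute)
      moreover have "V \<subseteq> {..3 * g}" using y3 by (auto simp: V_def)
      ultimately have "T \<in> Sub (3 * g div e)" using T by (auto simp: Sub_def)
      moreover have "D \<in> Sub (2 * e)" using D y3 by (auto simp: Sub_def)
      ultimately have "(y, G, D, T) \<in> X" using y3 G by (simp add: X_def)
      moreover have "S \<in> A (y, G, D, T)"
        using False D T S by (auto simp: A_def V_def G_def Let_def)
      ultimately show ?thesis by blast
    qed
  qed
  have A_le: "real (card (A p)) * psi ^ g * psi ^ (2 * L + K + 1) \<le> rho ^ k" if p: "p \<in> X" for p
  proof -
    obtain y G D T where p_eq: "p = (y, G, D, T)" by (cases p)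
    define V where "V = {m..y - m - L}"
    consider (sparse) "y < 2 * m + k"
      | (rich) "2 * m + k \<le> y" "D \<subseteq> {y - L<..y}" "card D = 2 * e" "T \<subseteq> V"
      | (none) "A p = {}"
    proof (cases "y < 2 * m + k \<or> (D \<subseteq> {y - L<..y} \<and> card D = 2 * e \<and> T \<subseteq> V)")
      case False
      then have "A p = {}" unfolding p_eq A_def V_def Let_def by (simp only: prod.case if_False) auto
      then show ?thesis by (rule none)
    qed (use sparse rich in linarith)
    then show ?thesis
    proof cases
      case sparse
      have G: "finite G" "card G \<le> K" using p finite_subset by (auto simp: p_eq X_def Sub_def)
      have "real (card (A p)) * psi ^ g * psi ^ (2 * L + K + 1) \<le> real (card (A p)) * psi ^ g * psi ^ (card G + 1)"
        using psi_pos psi1 G by (intro mult_left_mono power_decreasing) auto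
      also have "\<dots> \<le> psi ^ k"
        using card_semis_sparse_top_le[OF F(1) sparse G(1), of g] sparse by (simp add: p_eq A_def)
      also have "\<dots> \<le> rho ^ k" using psi_pos rho_bounds by (intro power_mono) auto
      finally show ?thesis .
    next
      case rich
      define C where "C = container (N D) V e T"
      define u where "u = card {m..y - m}"
      have y2: "2 * m + L \<le> y" using rich L by linarith
      have C: "C \<subseteq> V" by (auto simp: C_def container_def)
      have "3 * card C \<le> 2 * u"
        unfolding C_def u_def
      proof (rule card_container_le)
        show "N D v \<subseteq> {m..y - m} \<and> card (N D v) = 2 * e" if "v \<in> V" for v
          using N[of D y v] rich that by (auto simp: V_def)
        show "card {v \<in> V. u \<in> N D v} \<le> 2 * e" for u
        proof -
          \<comment> \<open>The relation is symmetric: \<open>u = d - v\<close> gives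
            \<open>v = d - u\<close>, so \<open>u\<close> has at most one neighbour for each
            \<open>d\<close>.\<close>
          have "{v \<in> V. u \<in> N D v} \<subseteq> (\<lambda>d. d - u) ` D"
          proof
            fix v assume v: "v \<in> {v \<in> V. u \<in> N D v}"
            then obtain d where d: "d \<in> D" "u = d - v" by (auto simp: N_def)
            have "v \<le> y - L" using v by (auto simp: V_def)
            moreover have "y - L < d" using rich d by auto
            ultimately have "v = d - u" using d by simp
            then show "v \<in> (\<lambda>d. d - u) ` D" using d(1) by (rule image_eqI)
          qed
          moreover have "finite D" using rich finite_subset by blast
          ultimately show ?thesis using rich(3) by (metis surj_card_le)
        qed
      qed (use rich e VU in \<open>auto simp: V_def\<close>)
      \<comment> \<open>The container bound refers to \<open>u\<close> positions, but only
        \<open>card V\<close> of them are weighted; an extra factor \<open>psi ^ L\<close> makes up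
        the difference.\<close>
      have Vu: "card V + L = u" using y2 by (simp add: V_def u_def)
      have ku: "k \<le> u" using rich by (simp add: u_def)
      have "A p = {S \<in> semis m F g. gaps S \<inter> {y<..} = G \<and> S \<inter> V \<subseteq> C}"
        using rich by (simp add: p_eq A_def V_def C_def Let_def)
      then have "real (card (A p)) * psi ^ g * psi ^ (L + 1) \<le> psi ^ card V * 2 ^ card C"
        using card_semis_rich_top_le[OF y2 C[unfolded V_def], of F g G] by (simp add: V_def)
      then have "real (card (A p)) * psi ^ g * psi ^ (L + 1) * psi ^ L \<le> psi ^ card V * 2 ^ card C * psi ^ L"
        using psi_pos by (intro mult_right_mono) auto
      also have "\<dots> = psi ^ u * 2 ^ card C" by (simp add: power_add flip: Vu)
      also have "\<dots> \<le> psi ^ u * (8/5) ^ u"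
        using two_power_le[OF \<open>3 * card C \<le> 2 * u\<close>] psi_pos by (intro mult_left_mono) auto
      also have "\<dots> = rho ^ u" by (simp only: rho_def power_mult_distrib mult.commute)
      also have "\<dots> \<le> rho ^ k" using rho_bounds ku by (intro power_decreasing) auto
      finally have "real (card (A p)) * psi ^ g * psi ^ (L + 1 + L) \<le> rho ^ k"
        by (simp only: power_add mult.assoc)
      moreover have "real (card (A p)) * psi ^ g * psi ^ (2 * L + K + 1) \<le> real (card (A p)) * psi ^ g * psi ^ (L + 1 + L)"
        using psi_pos psi1 by (intro mult_left_mono power_decreasing) auto
      ultimately show ?thesis by linarith
    next
      case none
      then show ?thesis using rho_bounds by simp
    qed
  qed
  have "card (semis m F g) \<le> card (\<Union>p\<in>X. A p)"
  proof (rule card_mono[OF _ cover])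
    have "finite (A p)" for p
      by (rule finite_subset[OF _ finite_semis[of m F g]]) (auto simp: A_def Let_def split: prod.splits if_splits)
    then show "finite (\<Union>p\<in>X. A p)" using fX by simp
  qed
  also have "\<dots> \<le> (\<Sum>p\<in>X. card (A p))" by (rule card_UN_le[OF fX])
  finally have "real (card (semis m F g)) \<le> (\<Sum>p\<in>X. real (card (A p)))" by (simp flip: of_nat_sum)
  then have "real (card (semis m F g)) * (psi ^ g * psi ^ (2 * L + K + 1))
      \<le> (\<Sum>p\<in>X. real (card (A p))) * (psi ^ g * psi ^ (2 * L + K + 1))"
    using psi_pos by (intro mult_right_mono) auto
  also have "\<dots> = (\<Sum>p\<in>X. real (card (A p)) * psi ^ g * psi ^ (2 * L + K + 1))"
    by (simp add: sum_distrib_right mult.assoc)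
  also have "\<dots> \<le> (\<Sum>p\<in>X. rho ^ k)" by (rule sum_mono) (rule A_le)
  also have "\<dots> = real (card X) * rho ^ k" by simp
  also have "\<dots> \<le> real (3 * g + 2) ^ (1 + K + 2 * e + 3 * g div e) * rho ^ k"
  proof (rule mult_right_mono)
    have cS: "card (Sub j) \<le> (3 * g + 2) ^ j" for j
      using card_bounded_subsets_le[of "{..3 * g}" j] by (simp add: Sub_def)
    have "card X = (3 * g + 1) * (card (Sub K) * (card (Sub (2 * e)) * card (Sub (3 * g div e))))"
      by (simp add: X_def card_cartesian_product)
    also have "\<dots> \<le> (3 * g + 2) ^ 1 * ((3 * g + 2) ^ K * ((3 * g + 2) ^ (2 * e) * (3 * g + 2) ^ (3 * g div e)))"
      by (intro mult_le_mono cS) simp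
    also have "\<dots> = (3 * g + 2) ^ (1 + K + 2 * e + 3 * g div e)"
      by (simp only: power_add mult.assoc)
    finally have "real (card X) \<le> real ((3 * g + 2) ^ (1 + K + 2 * e + 3 * g div e))"
      by (simp only: of_nat_le_iff)
    then show "real (card X) \<le> real (3 * g + 2) ^ (1 + K + 2 * e + 3 * g div e)"
      by (simp only: of_nat_power)
  qed (use rho_bounds in simp)
  finally show ?thesis by (simp add: mult.assoc)
qed


subsection \<open>Asymptotics\<close>

text \<open>The decay per 400 units of genus: \<open>(2 * psi) ^ 400\<close> converts weight 1/2
  into weight \<open>psi\<close>, about 300 pairs contribute 3/4 each, and at most 2 contribute the
  extra factor 5/3.\<close>

definition sigma :: real where "sigma = (2 * psi) ^ 400 * (3/4) ^ 300 * (5/3) ^ 2"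

text \<open>\<open>(2 * psi) ^ 4 * (3/4) ^ 3\<close> is only slightly below 1, and its hundredth
  power is small enough to absorb \<open>(5/3) ^ 2\<close>.\<close>

lemma sigma_bounds: "0 < sigma" "sigma < 1"
proof -
  show "0 < sigma" unfolding sigma_def using psi_pos by simp
  have "(2 * psi) ^ 4 * (3/4) ^ 3 \<le> 1.23608 ^ 4 * (3/4) ^ 3"
    using psi_pos psi_less by (intro mult_right_mono power_mono) auto
  also have "\<dots> \<le> (0.985 :: real)" by (simp add: power_numeral_reduce)
  finally have "((2 * psi) ^ 4 * (3/4) ^ 3) ^ 100 \<le> 0.985 ^ 100"
    using psi_pos by (intro power_mono) auto
  then have "((2 * psi) ^ 4 * (3/4) ^ 3) ^ 100 * (5/3) ^ 2 \<le> 0.985 ^ 100 * (5/3) ^ 2"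
    by (rule mult_right_mono) simp
  moreover have "((2 * psi) ^ 4 * (3/4) ^ 3) ^ 100 * (5/3) ^ 2 = sigma"
    unfolding sigma_def by (simp only: power_mult_distrib flip: power_mult) simp
  moreover have "0.985 ^ 100 * (5/3) ^ 2 < (1 :: real)" by (simp add: field_simps)
  ultimately show "sigma < 1" by linarith
qed

lemma card_semis_small_excess_le:
  assumes F: "3 * g \<le> 2 * F + 1" "F < 2 * m + 4 * k" and k: "k = g div 400"
  shows "real (card (semis m F g)) * psi ^ g \<le> (2 * psi) ^ 400 * (4/3) * sigma ^ k"
proof -
  define p where "p = (F + 1) div 2"
  \<comment> \<open>The first bound uses that \<open>F\<close> is about \<open>3 * g / 2\<close> or
    more, the second that \<open>F - 2 * m < 4 * k\<close>. Rounding is paid for by the constants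
    \<open>4/3\<close> and \<open>(2 * psi) ^ 400\<close>.\<close>
  have p: "300 * k \<le> Suc (p - 1)" "p - m \<le> 2 * k" using F unfolding p_def k by linarith+
  have g: "g \<le> 400 * k + 400" unfolding k by linarith
  have psi2: "1 \<le> 2 * psi"
    unfolding psi_def using real_le_rsqrt[of 2 5] by (simp add: power2_eq_square)
  have "real (card (semis m F g)) * psi ^ g = (real (card (semis m F g)) * (1/2) ^ g) * (2 * psi) ^ g"
    by (simp add: power_mult_distrib power_one_over)
  also have "\<dots> \<le> ((3/4) ^ (p - 1) * (5/3) ^ (p - m)) * (2 * psi) ^ g"
    using card_semis_half_weight_le[of m F g] psi_pos unfolding p_def by (intro mult_right_mono) auto
  also have "\<dots> \<le> ((4/3 * (3/4) ^ (300 * k)) * (5/3) ^ (2 * k)) * (2 * psi) ^ (400 * k + 400)"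
  proof (intro mult_mono power_increasing)
    have "(3/4 :: real) ^ Suc (p - 1) \<le> (3/4) ^ (300 * k)" using p by (intro power_decreasing) auto
    then show "(3/4 :: real) ^ (p - 1) \<le> 4/3 * (3/4) ^ (300 * k)" by simp
  qed (use p g psi2 in auto)
  also have "\<dots> = (2 * psi) ^ 400 * (4/3) * sigma ^ k"
    unfolding sigma_def power_add power_mult power_mult_distrib by simp
  finally show ?thesis .
qed

section \<open>Summing the class bounds over multiplicity and Frobenius number\<close>

lemma fails_Buchweitz_in_semis:
  assumes S: "numerical_semigroup S" "genus S = g" "fails_Buchweitz S" and g: "g \<ge> 1"
  shows "\<exists>m F. m \<le> 2 * g \<and> F \<le> 2 * g \<and> 3 * g \<le> 2 * F + 1 \<and> S \<in> semis m F g"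
proof -
  have fin: "finite (gaps S)" using S by (simp add: numerical_semigroup_def gaps_def)
  have ne: "gaps S \<noteq> {}" using S g by (auto simp: genus_def)
  define F where "F = Max (gaps S)"
  have FS: "F \<in> gaps S" using fin ne by (simp add: F_def)
  have F_max: "h \<le> F" if "h \<in> gaps S" for h using that fin by (simp add: F_def)
  have F2: "F < 2 * g" using gap_less_twice_genus[OF S(1) FS] S by simp
  define m where "m = (LEAST i. 0 < i \<and> i \<in> S)"
  have "i \<in> S" if "F < i" for i using F_max[of i] that by (auto simp: gaps_def)
  then have ex: "0 < F + 1 \<and> F + 1 \<in> S" by simp
  have m: "0 < m \<and> m \<in> S" unfolding m_def by (rule LeastI) (rule ex)
  have mF: "m \<le> F + 1" unfolding m_def by (rule Least_le) (rule ex)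
  have "i \<notin> S" if "0 < i" "i < m" for i
    using not_less_Least[of i "\<lambda>i. 0 < i \<and> i \<in> S"] that by (auto simp: m_def)
  then have "S \<in> semis m F g"
    using S m FS F_max by (force simp: semis_def gaps_def)
  moreover have "F \<noteq> 0" using FS S by (auto simp: gaps_def numerical_semigroup_def intro: ccontr)
  then have "3 * g \<le> 2 * F + 1" using fails_Buchweitz_large_gap[OF S(1,3) F_max] S by simp
  ultimately show ?thesis using mF F2 by (intro exI[of _ m] exI[of _ F]) auto
qed

lemma num_Buchweitz_failing_le:
  assumes g: "g \<ge> 1" and k: "k = g div 400" and L: "0 < L" "L \<le> k" and e: "0 < e"
    and K: "K = 2 * e * (2 * g div L + 1)"
  shows "real (num_Buchweitz_failing g) * psi ^ g \<le> real (2 * g + 1) ^ 2 *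
     ((2 * psi) ^ 400 * (4/3) * sigma ^ k
      + real (3 * g + 2) ^ (1 + K + 2 * e + 3 * g div e) * rho ^ k / psi ^ (2 * L + K + 1))"
    (is "_ \<le> _ * (?s + ?r)")
proof -
  define J where "J = {(m, F) \<in> {..2 * g} \<times> {..2 * g}. 3 * g \<le> 2 * F + 1}"
  have finJ: "finite J" by (rule finite_subset[of _ "{..2 * g} \<times> {..2 * g}"]) (auto simp: J_def)
  have nonneg: "?s \<ge> 0" "?r \<ge> 0" using sigma_bounds rho_bounds psi_pos by auto
  have term_le: "real (card (semis m F g)) * psi ^ g \<le> ?s + ?r" if "(m, F) \<in> J" for m F
  proof (cases "F < 2 * m + 4 * k")
    case True
    then show ?thesis using card_semis_small_excess_le[OF _ True k] that nonneg by (simp add: J_def)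
  next
    case False
    then have "real (card (semis m F g)) * psi ^ g * psi ^ (2 * L + K + 1)
        \<le> real (3 * g + 2) ^ (1 + K + 2 * e + 3 * g div e) * rho ^ k"
      using that by (intro card_semis_le[OF _ _ L e K]) (auto simp: J_def)
    then have "real (card (semis m F g)) * psi ^ g \<le> ?r"
      using psi_pos by (subst pos_le_divide_eq) auto
    then show ?thesis using nonneg by linarith
  qed
  have "{S. numerical_semigroup S \<and> genus S = g \<and> fails_Buchweitz S} \<subseteq> (\<Union>(m, F)\<in>J. semis m F g)"
    using fails_Buchweitz_in_semis[OF _ _ _ g] by (force simp: J_def)
  then have "num_Buchweitz_failing g \<le> card (\<Union>(m, F)\<in>J. semis m F g)"
    unfolding num_Buchweitz_failing_def
    by (rule card_mono[rotated]) (use finJ finite_semis in auto)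
  also have "\<dots> \<le> (\<Sum>p\<in>J. card (case p of (m, F) \<Rightarrow> semis m F g))" by (rule card_UN_le[OF finJ])
  finally have "real (num_Buchweitz_failing g) \<le> (\<Sum>p\<in>J. real (card (case p of (m, F) \<Rightarrow> semis m F g)))"
    by (simp flip: of_nat_sum)
  then have "real (num_Buchweitz_failing g) * psi ^ g
      \<le> (\<Sum>p\<in>J. real (card (case p of (m, F) \<Rightarrow> semis m F g))) * psi ^ g"
    using psi_pos by (intro mult_right_mono) auto
  also have "\<dots> = (\<Sum>p\<in>J. real (card (case p of (m, F) \<Rightarrow> semis m F g)) * psi ^ g)"
    by (rule sum_distrib_right)
  also have "\<dots> \<le> (\<Sum>p\<in>J. ?s + ?r)" using term_le by (intro sum_mono) auto
  also have "\<dots> = real (card J) * (?s + ?r)" by simp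
  also have "\<dots> \<le> real (2 * g + 1) ^ 2 * (?s + ?r)"
  proof (rule mult_right_mono)
    have "card J \<le> card ({..2 * g} \<times> {..2 * g})" by (rule card_mono) (auto simp: J_def)
    also have "\<dots> = (2 * g + 1) ^ 2" by (simp add: card_cartesian_product power2_eq_square)
    finally have "real (card J) \<le> real ((2 * g + 1) ^ 2)" by (simp only: of_nat_le_iff)
    then show "real (card J) \<le> real (2 * g + 1) ^ 2" by simp
  qed (use nonneg in linarith)
  finally show ?thesis .
qed

lemma power_le_powr_of_ge:
  fixes x :: real
  assumes "0 < x" "x < 1" "y \<le> real n"
  shows "x ^ n \<le> x powr y"
  using assms by (simp add: powr_mono' less_imp_le flip: powr_realpow)

lemma power_le_powr_of_le:
  fixes x :: real
  assumes "1 \<le> x" "real n \<le> y"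
  shows "x ^ n \<le> x powr y"
  using assms by (simp add: powr_mono flip: powr_realpow)

text \<open>With \<open>e\<close> of order \<open>t\<close> and \<open>L\<close> of order
  \<open>t ^ 3\<close>, where \<open>t ^ 4 = g\<close>, the exponents \<open>L\<close>,
  \<open>K\<close> and \<open>3 * g div e\<close> are all at most of order \<open>t ^ 3\<close>. The
  encoding cost is then \<open>exp (O (t ^ 3 * ln t))\<close>, against a gain exponential in
  \<open>t ^ 4\<close>.\<close>

lemma large_excess_term_le:
  fixes t :: real
  assumes t: "t = real g powr (1/4)" and t_ge: "t \<ge> 2" and e: "e = nat \<lfloor>t\<rfloor>" and L: "L = e ^ 3"
    and K: "K = 2 * e * (2 * g div L + 1)" and k: "k = g div 400"
  shows "real (3 * g + 2) ^ (1 + K + 2 * e + 3 * g div e) * rho ^ k / psi ^ (2 * L + K + 1)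
     \<le> (5 * t ^ 4) powr (43 * t ^ 3) * rho powr (t ^ 4 / 400 - 1) * (1 / psi) powr (37 * t ^ 3)"
proof -
  have g: "real g = t ^ 4"
  proof -
    have "g > 0" using t t_ge by (intro gr0I) auto
    then show ?thesis unfolding t by (simp flip: powr_realpow add: powr_powr)
  qed
  have e_le: "real e \<le> t" and e_ge: "t / 2 \<le> real e" and e0: "e > 0"
    unfolding e using t_ge by linarith+
  have L_le: "real L \<le> t ^ 3" and L_ge: "(t / 2) ^ 3 \<le> real L"
    unfolding L of_nat_power using e_le e_ge t_ge by (intro power_mono; simp)+
  have "0 < (t / 2) ^ 3" using t_ge by simp
  then have L_pos: "0 < real L" using L_ge by linarith
  have div1: "real (2 * g div L) \<le> 16 * t"
  proof -
    have "real (2 * g div L) \<le> 2 * t ^ 4 / real L"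
      using of_nat_div_le_of_nat[of "2 * g" L, where ?'a = real] by (simp add: g)
    also have "\<dots> \<le> 2 * t ^ 4 / (t / 2) ^ 3" using L_ge L_pos t_ge by (intro divide_left_mono mult_pos_pos) auto
    also have "\<dots> = 16 * t" using t_ge by (simp add: field_simps eval_nat_numeral)
    finally show ?thesis .
  qed
  have div2: "real (3 * g div e) \<le> 6 * t ^ 3"
  proof -
    have "real (3 * g div e) \<le> 3 * t ^ 4 / real e"
      using of_nat_div_le_of_nat[of "3 * g" e, where ?'a = real] by (simp add: g)
    also have "\<dots> \<le> 3 * t ^ 4 / (t / 2)" using e_ge t_ge by (intro divide_left_mono) auto
    also have "\<dots> = 6 * t ^ 3" using t_ge by (simp add: field_simps eval_nat_numeral)
    finally show ?thesis .
  qed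
  have pow: "1 \<le> t ^ 3" "t \<le> t ^ 3" "t ^ 2 \<le> t ^ 3"
    using t_ge power_increasing[of 1 3 t] power_increasing[of 2 3 t] by auto
  have "real K = 2 * real e * (real (2 * g div L) + 1)"
    unfolding K of_nat_mult of_nat_add by simp
  also have "\<dots> \<le> 2 * t * (16 * t + 1)" using e_le div1 t_ge by (intro mult_mono) auto
  also have "\<dots> = 32 * t ^ 2 + 2 * t" by (simp add: algebra_simps power2_eq_square)
  finally have K_le: "real K \<le> 32 * t ^ 2 + 2 * t" .
  have "real (3 * g + 2) \<le> 5 * t ^ 4" using g power_increasing[of 0 4 t] t_ge by simp
  then have "real (3 * g + 2) ^ (1 + K + 2 * e + 3 * g div e) \<le> (5 * t ^ 4) ^ (1 + K + 2 * e + 3 * g div e)"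
    by (intro power_mono) auto
  also have "\<dots> \<le> (5 * t ^ 4) powr (43 * t ^ 3)"
  proof (rule power_le_powr_of_le)
    have "1 \<le> t ^ 4" using t_ge by (intro one_le_power) simp
    then show "1 \<le> 5 * t ^ 4" by linarith
    \<comment> \<open>In units of \<open>t ^ 3\<close>:
      \<open>1 + (32 + 2) + 2 + 6 = 43\<close>.\<close>
    show "real (1 + K + 2 * e + 3 * g div e) \<le> 43 * t ^ 3"
      unfolding of_nat_add of_nat_mult of_nat_numeral of_nat_1 using K_le e_le div2 pow by linarith
  qed
  finally have a: "real (3 * g + 2) ^ (1 + K + 2 * e + 3 * g div e) \<le> (5 * t ^ 4) powr (43 * t ^ 3)" .
  have b: "rho ^ k \<le> rho powr (t ^ 4 / 400 - 1)"
  proof (rule power_le_powr_of_ge[OF rho_bounds(1,2)])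
    have "real g \<le> 400 * real k + 400" unfolding k by linarith
    then show "t ^ 4 / 400 - 1 \<le> real k" using g by simp
  qed
  have c: "(1 / psi) ^ (2 * L + K + 1) \<le> (1 / psi) powr (37 * t ^ 3)"
  proof (rule power_le_powr_of_le)
    show "1 \<le> 1 / psi" using psi_pos psi_less by simp
    \<comment> \<open>In units of \<open>t ^ 3\<close>:
      \<open>2 + (32 + 2) + 1 = 37\<close>.\<close>
    show "real (2 * L + K + 1) \<le> 37 * t ^ 3" using K_le L_le pow by simp
  qed
  have "real (3 * g + 2) ^ (1 + K + 2 * e + 3 * g div e) * rho ^ k / psi ^ (2 * L + K + 1)
     = real (3 * g + 2) ^ (1 + K + 2 * e + 3 * g div e) * rho ^ k * (1 / psi) ^ (2 * L + K + 1)"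
    by (simp add: power_one_over)
  also have "\<dots> \<le> (5 * t ^ 4) powr (43 * t ^ 3) * rho powr (t ^ 4 / 400 - 1) * (1 / psi) powr (37 * t ^ 3)"
    using a b c psi_pos rho_bounds by (intro mult_mono) auto
  finally show ?thesis .
qed

theorem theorem5:
  shows "(\<lambda>g. real (num_Buchweitz_failing g) / real (num_semigroups g)) \<longlonglongrightarrow> 0"
proof -
  define t where "t g = real g powr (1/4)" for g
  define f1 where "f1 g = (2 * g + 1) ^ 2 * ((2 * psi) ^ 400 * (4/3) * sigma powr (g / 400 - 1))" for g :: real
  define f2 where "f2 t = (2 * t ^ 4 + 1) ^ 2 * ((5 * t ^ 4) powr (43 * t ^ 3) * rho powr (t ^ 4 / 400 - 1)
                            * (1 / psi) powr (37 * t ^ 3))" for t :: real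
  have t_lim: "filterlim t at_top sequentially" unfolding t_def by real_asymp
  have f1_lim: "(f1 \<longlongrightarrow> 0) at_top"
    unfolding f1_def using sigma_bounds psi_pos by real_asymp
  have f2_lim: "(f2 \<longlongrightarrow> 0) at_top"
    unfolding f2_def using rho_bounds psi_pos psi_less by real_asymp
  have lim: "(\<lambda>g. (f1 (real g) + f2 (t g)) / psi) \<longlonglongrightarrow> 0"
  proof -
    have "(\<lambda>g. f1 (real g) + f2 (t g)) \<longlonglongrightarrow> 0 + 0"
      by (intro tendsto_add filterlim_compose[OF f1_lim] filterlim_compose[OF f2_lim]
            filterlim_real_sequentially t_lim)
    from tendsto_divide[OF this tendsto_const[of psi]] show ?thesis using psi_pos by simp
  qed
  \<comment> \<open>The second inequality yields \<open>L <= k\<close>, since \<open>L\<close> is at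
    most \<open>t g ^ 3\<close> and \<open>k\<close> at least \<open>g / 400 - 1\<close>.\<close>
  have ev: "eventually (\<lambda>g. t g \<ge> 2 \<and> t g ^ 3 \<le> t g ^ 4 / 400 - 1) sequentially"
  proof -
    have "eventually (\<lambda>t :: real. t \<ge> 2 \<and> t ^ 3 \<le> t ^ 4 / 400 - 1) at_top"
      by (intro eventually_conj; real_asymp)
    then show ?thesis using t_lim by (rule eventually_compose_filterlim)
  qed
  show ?thesis
  proof (rule tendsto_sandwich[OF _ _ tendsto_const lim])
    show "\<forall>\<^sub>F g in sequentially. 0 \<le> real (num_Buchweitz_failing g) / real (num_semigroups g)"
      by simp
    show "\<forall>\<^sub>F g in sequentially. real (num_Buchweitz_failing g) / real (num_semigroups g)
            \<le> (f1 (real g) + f2 (t g)) / psi"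
      using ev
    proof eventually_elim
      case (elim g)
      define e where "e = nat \<lfloor>t g\<rfloor>"
      define L where "L = e ^ 3"
      define k where "k = g div 400"
      define K where "K = 2 * e * (2 * g div L + 1)"
      have g1: "g \<ge> 1" using elim by (cases "g = 0") (auto simp: t_def)
      have tg: "t g ^ 4 = real g" using g1 by (simp add: t_def powr_powr flip: powr_realpow)
      have e: "e > 0" "real e \<le> t g" using elim unfolding e_def by linarith+
      have gk: "real g \<le> 400 * real k + 400" unfolding k_def by linarith
      have "real L \<le> t g ^ 3" unfolding L_def of_nat_power using e by (intro power_mono) auto
      also have "\<dots> \<le> real k" using elim tg gk by simp
      finally have L: "0 < L" "L \<le> k" using e by (auto simp: L_def)
      have "sigma ^ k \<le> sigma powr (real g / 400 - 1)"
        using gk by (intro power_le_powr_of_ge sigma_bounds) simp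
      then have s: "(2 * psi) ^ 400 * (4/3) * sigma ^ k \<le> (2 * psi) ^ 400 * (4/3) * sigma powr (real g / 400 - 1)"
        using psi_pos by (intro mult_left_mono) auto
      have "real (num_Buchweitz_failing g) * psi ^ g \<le> real (2 * g + 1) ^ 2 *
         ((2 * psi) ^ 400 * (4/3) * sigma ^ k
          + real (3 * g + 2) ^ (1 + K + 2 * e + 3 * g div e) * rho ^ k / psi ^ (2 * L + K + 1))"
        by (rule num_Buchweitz_failing_le[OF g1 k_def L e(1) K_def])
      also have "\<dots> \<le> real (2 * g + 1) ^ 2 *
         ((2 * psi) ^ 400 * (4/3) * sigma powr (real g / 400 - 1)
          + (5 * t g ^ 4) powr (43 * t g ^ 3) * rho powr (t g ^ 4 / 400 - 1) * (1 / psi) powr (37 * t g ^ 3))"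
        by (intro mult_left_mono add_mono s large_excess_term_le[OF t_def _ e_def L_def K_def k_def])
           (use elim in auto)
      also have "\<dots> = f1 (real g) + f2 (t g)"
        by (simp only: f1_def f2_def tg distrib_left of_nat_add of_nat_mult of_nat_numeral of_nat_1)
      finally have bad: "real (num_Buchweitz_failing g) * psi ^ g \<le> f1 (real g) + f2 (t g)" .
      have "real (fib (Suc g)) * psi ^ g \<le> real (num_semigroups g) * psi ^ g"
        using fib_le_num_semigroups[of g] psi_pos by (intro mult_right_mono) auto
      then have good: "psi \<le> real (num_semigroups g) * psi ^ g" using fib_psi_ge[of g] by linarith
      \<comment> \<open>Scaling both counts by \<open>psi ^ g\<close> leaves a denominator of at
        least \<open>psi\<close>.\<close>
      have "real (num_Buchweitz_failing g) / real (num_semigroups g)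
          = (real (num_Buchweitz_failing g) * psi ^ g) / (real (num_semigroups g) * psi ^ g)"
        using psi_pos by simp
      also have "\<dots> \<le> (f1 (real g) + f2 (t g)) / psi"
      proof (rule frac_le[OF _ bad psi_pos good])
        show "0 \<le> f1 (real g) + f2 (t g)" by (rule order_trans[OF _ bad]) (use psi_pos in simp)
      qed
      finally show ?case .
    qed
  qed
qed

end
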